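(* Let $M$ be a closed, connected, oriented $3$-manifold and let $\omega_{\mathrm c}$ be a formally integrable complex $1$-form on $M$ for which there exists a pure imaginary $1$-form $\mathrm{i}\alpha$ (with $\alpha$ a smooth real-valued $1$-form on $M$) such that $$\mathrm{d}\omega_{\mathrm c}=\mathrm{i}\alpha\wedge\omega_{\mathrm c}.$$ Then any other formally integrable complex $1$-form on $M$ defining the same $1$-dimensional foliation as $\omega_{\mathrm c}$ has the same Bott invariant as $\omega_{\mathrm c}$.
   Context: All objects are smooth. A formally integrable complex $1$-form on a $3$-manifold $M$ is a complex-valued $1$-form $\omega_{\mathrm c}=\omega_1+\mathrm{i}\omega_2$ whose real and imaginary parts $\omega_1,\omega_2$ are pointwise linearly independent, and which satisfies $\omega_{\mathrm c}\wedge\mathrm{d}\omega_{\mathrm c}=0$. The $1$-dimensional foliation defined by $\omega_{\mathrm c}$ is the one tangent to the line field $\ker\omega_1\cap\ker\omega_2$ (as an unoriented foliation; a second form defining the same foliation may induce either transverse orientation). Bott invariant: for a formally integrable complex $1$-form $\omega_{\mathrm c}$ on a closed, connected, oriented $3$-manifold $M$ there is a complex-valued $1$-form $\alpha_{\mathrm c}$ with $\mathrm{d}\omega_{\mathrm c}=\alpha_{\mathrm c}\wedge\omega_{\mathrm c}$, and the complex number $\int_M\alpha_{\mathrm c}\wedge\mathrm{d}\alpha_{\mathrm c}$ does not depend on the choice of $\alpha_{\mathrm c}$, nor does it change when $\omega_{\mathrm c}$ is multiplied by a nowhere zero smooth complex-valued function. This number is the Bott invariant of $\omega_{\mathrm c}$.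 *)

theory Defs
  imports "HOL-Analysis.Analysis"
begin

section \<open>Smooth maps between open subsets of Euclidean spaces\<close>

text \<open>Only used on open sets: being \<open>C\<^sup>k\<^sup>+\<^sup>1\<close> means being differentiable with all directional
  derivatives of class \<open>C\<^sup>k\<close>. For a complex-valued map the derivative is the real one.\<close>

primrec Ck_on :: "nat \<Rightarrow> 'b::real_normed_vector set \<Rightarrow> ('b \<Rightarrow> 'c::real_normed_vector) \<Rightarrow> bool" where
  "Ck_on 0 S f \<longleftrightarrow> continuous_on S f"
| "Ck_on (Suc k) S f \<longleftrightarrow>
     (\<forall>x\<in>S. f differentiable (at x)) \<and> (\<forall>v. Ck_on k S (\<lambda>x. frechet_derivative f (at x) v))"

definition smooth_on :: "'b::real_normed_vector set \<Rightarrow> ('b \<Rightarrow> 'c::real_normed_vector) \<Rightarrow> bool" where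
  "smooth_on S f \<longleftrightarrow> (\<forall>k. Ck_on k S f)"


section \<open>Oriented 3-manifolds\<close>

text \<open>A manifold is carried by a whole type; its smooth structure and orientation are given by an
  oriented atlas. The atlas need not be maximal: an arbitrary oriented atlas determines the smooth
  structure, the orientation and the differential forms.\<close>

type_synonym 'a chart = "'a set \<times> ('a \<Rightarrow> real^3)"

abbreviation chart_dom :: "'a chart \<Rightarrow> 'a set" where
  "chart_dom c \<equiv> fst c"

abbreviation coord :: "'a chart \<Rightarrow> 'a \<Rightarrow> real^3" where
  "coord c \<equiv> snd c"

definition chart_img :: "'a chart \<Rightarrow> (real^3) set" where
  "chart_img c = coord c ` chart_dom c"

definition param :: "'a chart \<Rightarrow> real^3 \<Rightarrow> 'a" where
  "param c = inv_into (chart_dom c) (coord c)"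

definition is_chart :: "'a::topological_space chart \<Rightarrow> bool" where
  "is_chart c \<longleftrightarrow> open (chart_dom c) \<and> open (chart_img c) \<and>
     homeomorphism (chart_dom c) (chart_img c) (coord c) (param c)"

definition overlap :: "'a chart \<Rightarrow> 'a chart \<Rightarrow> (real^3) set" where
  "overlap c d = coord c ` (chart_dom c \<inter> chart_dom d)"

definition transition :: "'a chart \<Rightarrow> 'a chart \<Rightarrow> real^3 \<Rightarrow> real^3" where
  "transition c d = coord d \<circ> param c"

definition oriented_atlas :: "'a::topological_space chart set \<Rightarrow> bool" where
  "oriented_atlas M \<longleftrightarrow>
     (\<forall>c\<in>M. is_chart c) \<and> (\<Union>c\<in>M. chart_dom c) = UNIV \<and>
     (\<forall>c\<in>M. \<forall>d\<in>M. smooth_on (overlap c d) (transition c d) \<and>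
        (\<forall>x\<in>overlap c d. det (jacobian (transition c d) (at x)) > 0))"

text \<open>The Hausdorff property is the sort constraint; second countability follows from compactness.\<close>

definition closed_connected_oriented_3manifold :: "'a::t2_space chart set \<Rightarrow> bool" where
  "closed_connected_oriented_3manifold M \<longleftrightarrow>
     oriented_atlas M \<and> compact (UNIV :: 'a set) \<and> connected (UNIV :: 'a set)"


section \<open>Differential forms\<close>

text \<open>A \<open>k\<close>-form is given by its local expressions in the charts of the atlas: \<open>\<omega> c x\<close> is the
  multilinear form at the point with coordinates \<open>x\<close> in the chart \<open>c\<close>, taking as arguments tangent
  vectors written in the coordinates of \<open>c\<close>. Values at \<open>x\<close> outside the image of \<open>c\<close>, or for \<open>c\<close>
  outside the atlas, carry no meaning. The target \<open>'b\<close> is \<open>real\<close> or \<open>complex\<close>.\<close>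

type_synonym ('a, 'b) form1 = "'a chart \<Rightarrow> real^3 \<Rightarrow> real^3 \<Rightarrow> 'b"
type_synonym ('a, 'b) form2 = "'a chart \<Rightarrow> real^3 \<Rightarrow> real^3 \<Rightarrow> real^3 \<Rightarrow> 'b"
type_synonym ('a, 'b) form3 = "'a chart \<Rightarrow> real^3 \<Rightarrow> real^3 \<Rightarrow> real^3 \<Rightarrow> real^3 \<Rightarrow> 'b"

definition smooth_1form :: "'a chart set \<Rightarrow> ('a, 'b::real_normed_vector) form1 \<Rightarrow> bool" where
  "smooth_1form M \<omega> \<longleftrightarrow>
     (\<forall>c\<in>M. (\<forall>x\<in>chart_img c. linear (\<omega> c x)) \<and> (\<forall>v. smooth_on (chart_img c) (\<lambda>x. \<omega> c x v))) \<and>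
     (\<forall>c\<in>M. \<forall>d\<in>M. \<forall>x\<in>overlap c d. \<forall>v.
        \<omega> c x v = \<omega> d (transition c d x) (frechet_derivative (transition c d) (at x) v))"

text \<open>Equality of local objects at all points of the manifold.\<close>

definition eq_on_manifold :: "'a chart set \<Rightarrow> ('a chart \<Rightarrow> real^3 \<Rightarrow> 't) \<Rightarrow> ('a chart \<Rightarrow> real^3 \<Rightarrow> 't) \<Rightarrow> bool" where
  "eq_on_manifold M \<eta> \<theta> \<longleftrightarrow> (\<forall>c\<in>M. \<forall>x\<in>chart_img c. \<eta> c x = \<theta> c x)"

definition wedge11 :: "('a, 'b::real_normed_algebra) form1 \<Rightarrow> ('a, 'b) form1 \<Rightarrow> ('a, 'b) form2" where
  "wedge11 \<alpha> \<beta> = (\<lambda>c x u v. \<alpha> c x u * \<beta> c x v - \<alpha> c x v * \<beta> c x u)"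

definition wedge12 :: "('a, 'b::real_normed_algebra) form1 \<Rightarrow> ('a, 'b) form2 \<Rightarrow> ('a, 'b) form3" where
  "wedge12 \<alpha> \<beta> = (\<lambda>c x u v w. \<alpha> c x u * \<beta> c x v w - \<alpha> c x v * \<beta> c x u w + \<alpha> c x w * \<beta> c x u v)"

text \<open>For constant vector fields \<open>u\<close>, \<open>v\<close> in a chart,
  \<open>d\<omega>(u,v) = u(\<omega>(v)) - v(\<omega>(u))\<close>, as their bracket vanishes.\<close>

definition ext_deriv :: "('a, 'b::real_normed_vector) form1 \<Rightarrow> ('a, 'b) form2" where
  "ext_deriv \<omega> = (\<lambda>c x u v. frechet_derivative (\<lambda>y. \<omega> c y v) (at x) u
                          - frechet_derivative (\<lambda>y. \<omega> c y u) (at x) v)"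

definition imag_form :: "('a, real) form1 \<Rightarrow> ('a, complex) form1" where
  "imag_form \<alpha> = (\<lambda>c x v. \<i> * complex_of_real (\<alpha> c x v))"


section \<open>Integration of 3-forms\<close>

text \<open>Smooth partition of unity, indexed by a finite set \<open>F\<close> of charts and subordinate to their
  domains.\<close>

definition partition_of_unity ::
  "'a::topological_space chart set \<Rightarrow> 'a chart set \<Rightarrow> ('a chart \<Rightarrow> 'a \<Rightarrow> real) \<Rightarrow> bool" where
  "partition_of_unity M F \<rho> \<longleftrightarrow> finite F \<and> F \<subseteq> M \<and>
     (\<forall>c\<in>F. (\<forall>d\<in>M. smooth_on (chart_img d) (\<rho> c \<circ> param d)) \<and>
            (\<forall>p. \<rho> c p \<ge> 0) \<and> closure {p. \<rho> c p \<noteq> 0} \<subseteq> chart_dom c) \<and>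
     (\<forall>p. (\<Sum>c\<in>F. \<rho> c p) = 1)"

definition chart_integral :: "'a chart \<Rightarrow> ('a \<Rightarrow> real) \<Rightarrow> ('a, complex) form3 \<Rightarrow> complex" where
  "chart_integral c \<rho> \<eta> =
     integral (chart_img c)
       (\<lambda>x. complex_of_real (\<rho> (param c x)) * \<eta> c x (axis 1 1) (axis 2 1) (axis 3 1))"

text \<open>For a smooth 3-form the value is the same for all partitions of unity.\<close>

definition form_integral :: "'a::topological_space chart set \<Rightarrow> ('a, complex) form3 \<Rightarrow> complex" where
  "form_integral M \<eta> =
     (THE z. \<exists>F \<rho>. partition_of_unity M F \<rho> \<and> z = (\<Sum>c\<in>F. chart_integral c (\<rho> c) \<eta>))"


section \<open>Formally integrable complex 1-forms\<close>

definition formally_integrable :: "'a chart set \<Rightarrow> ('a, complex) form1 \<Rightarrow> bool" where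
  "formally_integrable M \<omega> \<longleftrightarrow>
     smooth_1form M \<omega> \<and>
     (\<forall>c\<in>M. \<forall>x\<in>chart_img c. \<forall>a b :: real.
        (\<forall>v. a * Re (\<omega> c x v) + b * Im (\<omega> c x v) = 0) \<longrightarrow> a = 0 \<and> b = 0) \<and>
     eq_on_manifold M (wedge12 \<omega> (ext_deriv \<omega>)) (\<lambda>c x u v w. 0)"

definition line_field :: "('a, complex) form1 \<Rightarrow> 'a chart \<Rightarrow> real^3 \<Rightarrow> (real^3) set" where
  "line_field \<omega> c x = {v. Re (\<omega> c x v) = 0} \<inter> {v. Im (\<omega> c x v) = 0}"

text \<open>A foliation is determined by its tangent distribution, so two forms define the same (unoriented)
  foliation iff they have the same line field.\<close>

definition same_foliation :: "'a chart set \<Rightarrow> ('a, complex) form1 \<Rightarrow> ('a, complex) form1 \<Rightarrow> bool" where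
  "same_foliation M \<omega> \<omega>' \<longleftrightarrow> eq_on_manifold M (line_field \<omega>) (line_field \<omega>')"

definition bott_invariant :: "'a::topological_space chart set \<Rightarrow> ('a, complex) form1 \<Rightarrow> complex" where
  "bott_invariant M \<omega> =
     (THE z. \<exists>\<alpha>. smooth_1form M \<alpha> \<and> eq_on_manifold M (ext_deriv \<omega>) (wedge11 \<alpha> \<omega>) \<and>
                 z = form_integral M (wedge12 \<alpha> (ext_deriv \<alpha>)))"

end

theory Submission
  imports Defs
begin

text \<open>Write \<open>\<langle>\<beta>, \<gamma>\<rangle>\<close> for the integral of \<open>\<beta> \<and> d\<gamma>\<close> over the manifold. By Stokes' theorem this bilinear
pairing of smooth 1-forms is symmetric, since \<open>d(\<beta> \<and> \<gamma>) = d\<beta> \<and> \<gamma> - \<beta> \<and> d\<gamma>\<close>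
(\<open>pairing_symmetric\<close>). The Bott invariant of \<open>\<omega>\<close> is \<open>\<langle>\<alpha>, \<alpha>\<rangle>\<close> for any \<open>\<alpha>\<close> with
\<open>d\<omega> = \<alpha> \<and> \<omega>\<close> (\<open>bott_invariant_eq_pairing\<close>), so the two Bott invariants can be compared by
algebra with the pairing.

Let \<open>\<beta> = \<i>\<alpha>\<close> be the given imaginary form. Conjugating \<open>d\<omega> = \<beta> \<and> \<omega>\<close> gives
\<open>d\<eta> = - \<beta> \<and> \<eta>\<close> for \<open>\<eta> = cnj \<omega>\<close>; this is where \<open>\<beta>\<close> being imaginary enters. A form \<open>\<omega>'\<close> with
the same kernel is a combination \<open>\<omega>' = p \<omega> + q \<eta>\<close> with smooth coefficients, and the independence
of its real and imaginary parts says \<open>\<bar>p\<bar> \<noteq> \<bar>q\<bar>\<close>. As the manifold is connected, the same one of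
\<open>p\<close> and \<open>q\<close> has the larger modulus everywhere. The hypotheses are symmetric under exchanging
\<open>(\<omega>, \<beta>)\<close> with \<open>(\<eta>, - \<beta>)\<close>, so \<open>p\<close> may be taken to vanish nowhere.

Put \<open>\<delta> = dp/p\<close> and \<open>\<theta> = dq - q \<delta> - 2 q \<beta>\<close>. Then
\<open>d\<omega>' = (\<delta> + \<beta>) \<and> \<omega>' + \<theta> \<and> \<eta>\<close>, so \<open>\<omega>' \<and> d\<omega>' = 0\<close> forces \<open>\<theta> = a \<omega> + b \<eta>\<close>, and
\<open>\<theta> \<and> \<eta> = a \<omega> \<and> \<eta> = (a/p) \<omega>' \<and> \<eta>\<close>. Hence \<open>d\<omega>' = \<alpha>' \<and> \<omega>'\<close> for
\<open>\<alpha>' = \<delta> + \<beta> + \<sigma>\<close> with \<open>\<sigma> = - (a/p) \<eta>\<close>. In \<open>\<langle>\<alpha>', \<alpha>'\<rangle>\<close> all terms with \<open>\<delta>\<close> vanish by symmetry,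
because \<open>\<delta>\<close> is closed. Differentiating \<open>d\<eta> = - \<beta> \<and> \<eta>\<close> gives \<open>\<eta> \<and> d\<beta> = 0\<close>, whence
\<open>\<langle>\<sigma>, \<beta>\<rangle> = 0\<close>; and \<open>\<sigma> \<and> d\<sigma> = 0\<close> because \<open>\<sigma>\<close> is a multiple of the integrable form \<open>\<eta>\<close>. Only
\<open>\<langle>\<beta>, \<beta>\<rangle>\<close>, the Bott invariant of \<open>\<omega>\<close>, remains (\<open>bott_form_of_combination\<close>).

The integral of a 3-form is characterised by a partition of unity, so the pairing only makes sense
once smooth partitions of unity exist (\<open>partition_of_unity_exists\<close>, from compactness and the flat
function \<open>exp (- 1/t)\<close>) and give the same value (\<open>partition_integral_independent\<close>, from the change of
variables formula on chart overlaps). Cutting \<open>\<beta>\<close> with a partition of unity then reduces Stokes'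
theorem to one chart, where it says that a partial derivative of a compactly supported function has
integral zero.\<close>

section \<open>Calculus of smooth maps\<close>

lemma frechet_derivative_cong_open:
  assumes "open S" "x \<in> S" "\<And>y. y \<in> S \<Longrightarrow> f y = g y"
  shows "frechet_derivative f (at x) = frechet_derivative g (at x)"
proof -
  have "(f has_derivative D) (at x) \<longleftrightarrow> (g has_derivative D) (at x)" for D
    using assms by (intro iffI; elim has_derivative_transform_within_open) auto
  then show ?thesis unfolding frechet_derivative_def by simp
qed

lemma differentiable_cong_open:
  assumes "open S" "x \<in> S" "\<And>y. y \<in> S \<Longrightarrow> f y = g y"
  shows "f differentiable (at x) \<longleftrightarrow> g differentiable (at x)"
  unfolding differentiable_def
proof (rule ex_cong1)
  fix D
  show "(f has_derivative D) (at x) \<longleftrightarrow> (g has_derivative D) (at x)"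
    using assms by (intro iffI; elim has_derivative_transform_within_open) auto
qed

lemma Ck_on_cong:
  assumes "open S" "\<And>y. y \<in> S \<Longrightarrow> f y = g y"
  shows "Ck_on k S f \<longleftrightarrow> Ck_on k S g"
  using assms(2)
proof (induction k arbitrary: f g)
  case 0 then show ?case by (simp cong: continuous_on_cong)
next
  case (Suc k)
  have "Ck_on k S (\<lambda>x. frechet_derivative f (at x) v) \<longleftrightarrow> Ck_on k S (\<lambda>x. frechet_derivative g (at x) v)" for v
    by (rule Suc.IH) (metis Suc.prems assms(1) frechet_derivative_cong_open)
  moreover have "(\<forall>x\<in>S. f differentiable (at x)) \<longleftrightarrow> (\<forall>x\<in>S. g differentiable (at x))"
    by (intro ball_cong refl differentiable_cong_open[OF assms(1)]) (use Suc.prems in auto)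
  ultimately show ?case by simp
qed

lemma Ck_on_lower: "Ck_on (Suc k) S f \<Longrightarrow> Ck_on k S f"
proof (induction k arbitrary: f)
  case 0 then show ?case
    by (auto intro!: differentiable_imp_continuous_on simp: differentiable_on_def
        dest!: differentiable_at_withinI)
next
  case (Suc k) then show ?case by auto
qed

lemma Ck_on_Un:
  assumes "open S" "open T" "Ck_on k S f" "Ck_on k T f"
  shows "Ck_on k (S \<union> T) f"
  using assms(3,4)
proof (induction k arbitrary: f)
  case 0 then show ?case using assms(1,2) by (auto intro: continuous_on_open_Un)
next
  case (Suc k) then show ?case by auto
qed

lemma Ck_on_const: "Ck_on k S (\<lambda>x. c)"
  by (induction k arbitrary: c) auto

text \<open>An explicit derivative replaces \<^const>\<open>frechet_derivative\<close>, so that smoothness of compound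
expressions can be proved by induction on the order with the usual differentiation rules.\<close>

lemma Ck_on_SucI:
  assumes "open S" "\<And>x. x \<in> S \<Longrightarrow> (f has_derivative F x) (at x)" "\<And>v. Ck_on k S (\<lambda>x. F x v)"
  shows "Ck_on (Suc k) S f"
proof -
  have e: "frechet_derivative f (at x) v = F x v" if "x \<in> S" for x v
    using frechet_derivative_at[OF assms(2)[OF that]] by simp
  have "Ck_on k S (\<lambda>x. frechet_derivative f (at x) v)" for v
    using Ck_on_cong[OF assms(1), of "\<lambda>x. frechet_derivative f (at x) v" "\<lambda>x. F x v"] e assms(3) by blast
  with assms(2) show ?thesis by (auto simp: differentiable_def)
qed

lemma Ck_on_SucD:
  assumes "Ck_on (Suc k) S f" "x \<in> S"
  shows "(f has_derivative frechet_derivative f (at x)) (at x)"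
  using assms frechet_derivative_works by auto

lemma Ck_on_add:
  assumes S: "open S" and "Ck_on k S f" "Ck_on k S g"
  shows "Ck_on k S (\<lambda>x. f x + g x)"
  using assms(2,3)
proof (induction k arbitrary: f g)
  case 0 then show ?case by (auto intro: continuous_intros)
next
  case (Suc k)
  show ?case
    by (rule Ck_on_SucI[OF S, where F="\<lambda>x v. frechet_derivative f (at x) v + frechet_derivative g (at x) v"])
      (use Suc Ck_on_SucD[OF Suc.prems(1)] Ck_on_SucD[OF Suc.prems(2)] in \<open>auto intro!: has_derivative_add\<close>)
qed

lemma Ck_on_bounded_linear:
  assumes S: "open S" and "bounded_linear h" and "Ck_on k S f"
  shows "Ck_on k S (\<lambda>x. h (f x))"
  using assms(3)
proof (induction k arbitrary: f)
  case 0 then show ?case using assms(2) by (auto intro: bounded_linear.continuous_on)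
next
  case (Suc k)
  show ?case
    by (rule Ck_on_SucI[OF S, where F="\<lambda>x v. h (frechet_derivative f (at x) v)"])
      (use Suc in \<open>auto intro!: bounded_linear.has_derivative[OF assms(2)] Ck_on_SucD[OF Suc.prems(1)]\<close>)
qed

lemma Ck_on_bounded_bilinear:
  assumes S: "open S" and h: "bounded_bilinear h" and "Ck_on k S f" "Ck_on k S g"
  shows "Ck_on k S (\<lambda>x. h (f x) (g x))"
  using assms(3,4)
proof (induction k arbitrary: f g)
  case 0 then show ?case using h by (auto intro: bounded_bilinear.continuous_on)
next
  case (Suc k)
  show ?case
  proof (rule Ck_on_SucI[OF S, where F="\<lambda>x v. h (f x) (frechet_derivative g (at x) v) + h (frechet_derivative f (at x) v) (g x)"])
    fix x assume "x \<in> S"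
    then show "((\<lambda>x. h (f x) (g x)) has_derivative (\<lambda>v. h (f x) (frechet_derivative g (at x) v) + h (frechet_derivative f (at x) v) (g x))) (at x)"
      using bounded_bilinear.FDERIV[OF h Ck_on_SucD[OF Suc.prems(1)] Ck_on_SucD[OF Suc.prems(2)]] by blast
  next
    fix v
    show "Ck_on k S (\<lambda>x. h (f x) (frechet_derivative g (at x) v) + h (frechet_derivative f (at x) v) (g x))"
      using Suc.prems Ck_on_lower[OF Suc.prems(1)] Ck_on_lower[OF Suc.prems(2)]
      by (intro Ck_on_add[OF S] Suc.IH) auto
  qed
qed

lemma Ck_on_sum:
  assumes "open S" "\<And>i. i \<in> I \<Longrightarrow> Ck_on k S (f i)"
  shows "Ck_on k S (\<lambda>x. \<Sum>i\<in>I. f i x)"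
  using assms(2)
  by (induction I rule: infinite_finite_induct) (auto intro!: Ck_on_const Ck_on_add[OF assms(1)])

lemma Ck_on_inverse:
  fixes f :: "_ \<Rightarrow> 'c::real_normed_field"
  assumes S: "open S" and "Ck_on k S f" and nz: "\<And>x. x \<in> S \<Longrightarrow> f x \<noteq> 0"
  shows "Ck_on k S (\<lambda>x. inverse (f x))"
  using assms(2)
proof (induction k)
  case 0 then show ?case using nz by (auto intro!: continuous_intros)
next
  case (Suc k)
  have IH: "Ck_on k S (\<lambda>x. inverse (f x))" using Suc Ck_on_lower by blast
  show ?case
  proof (rule Ck_on_SucI[OF S, where F="\<lambda>x v. - (inverse (f x) * frechet_derivative f (at x) v * inverse (f x))"])
    fix x assume "x \<in> S"
    then show "((\<lambda>x. inverse (f x)) has_derivative (\<lambda>v. - (inverse (f x) * frechet_derivative f (at x) v * inverse (f x)))) (at x)"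
      using nz Ck_on_SucD[OF Suc.prems] by (intro Deriv.has_derivative_inverse) auto
  next
    fix v
    show "Ck_on k S (\<lambda>x. - (inverse (f x) * frechet_derivative f (at x) v * inverse (f x)))"
      by (intro Ck_on_bounded_linear[OF S bounded_linear_minus[OF bounded_linear_ident]]
          Ck_on_bounded_bilinear[OF S bounded_bilinear_mult] IH) (use Suc.prems in auto)
  qed
qed

text \<open>Expanding the inner derivative in a basis turns the chain rule into a sum of products of maps
\<open>x \<mapsto> Dg (f x) b\<close>, which are again compositions with \<open>f\<close>; this lets the induction on the order
proceed.\<close>

lemma Ck_on_compose:
  fixes f :: "'a::real_normed_vector \<Rightarrow> 'b::euclidean_space"
  assumes S: "open S" and T: "open T" and fS: "f ` S \<subseteq> T" and "Ck_on k S f" "Ck_on k T g"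
  shows "Ck_on k S (\<lambda>x. g (f x))"
  using assms(4,5)
proof (induction k arbitrary: g)
  case 0 then show ?case using fS by (auto intro: continuous_on_compose2)
next
  case (Suc k)
  note fl = Ck_on_lower[OF Suc.prems(1)]
  show ?case
  proof (rule Ck_on_SucI[OF S, where F="\<lambda>x v. \<Sum>b\<in>Basis. (frechet_derivative f (at x) v \<bullet> b) *\<^sub>R frechet_derivative g (at (f x)) b"])
    fix x assume x: "x \<in> S"
    have dg: "(g has_derivative frechet_derivative g (at (f x))) (at (f x))"
      using Ck_on_SucD[OF Suc.prems(2)] fS x by blast
    have d: "((\<lambda>x. g (f x)) has_derivative (\<lambda>v. frechet_derivative g (at (f x)) (frechet_derivative f (at x) v))) (at x)"
      using has_derivative_compose[OF Ck_on_SucD[OF Suc.prems(1) x] dg] .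
    have rep: "frechet_derivative g (at (f x)) w = (\<Sum>b\<in>Basis. (w \<bullet> b) *\<^sub>R frechet_derivative g (at (f x)) b)" for w
    proof -
      interpret linear "frechet_derivative g (at (f x))" using dg has_derivative_linear by blast
      show ?thesis by (subst (1) euclidean_representation[symmetric]) (simp add: sum scale)
    qed
    show "((\<lambda>x. g (f x)) has_derivative (\<lambda>v. \<Sum>b\<in>Basis. (frechet_derivative f (at x) v \<bullet> b) *\<^sub>R frechet_derivative g (at (f x)) b)) (at x)"
      by (rule has_derivative_eq_rhs[OF d]) (rule ext, rule rep)
  next
    fix v
    show "Ck_on k S (\<lambda>x. \<Sum>b\<in>Basis. (frechet_derivative f (at x) v \<bullet> b) *\<^sub>R frechet_derivative g (at (f x)) b)"
      by (intro Ck_on_sum[OF S] Ck_on_bounded_bilinear[OF S bounded_bilinear_scaleR]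
          Ck_on_bounded_linear[OF S bounded_linear_inner_left] Suc.IH[OF fl]) (use Suc.prems in auto)
  qed
qed

lemma smooth_on_cong: "open S \<Longrightarrow> (\<And>y. y \<in> S \<Longrightarrow> f y = g y) \<Longrightarrow> smooth_on S f \<longleftrightarrow> smooth_on S g"
  unfolding smooth_on_def using Ck_on_cong by blast

lemma smooth_on_Un: "open S \<Longrightarrow> open T \<Longrightarrow> smooth_on S f \<Longrightarrow> smooth_on T f \<Longrightarrow> smooth_on (S \<union> T) f"
  unfolding smooth_on_def using Ck_on_Un by blast

lemma smooth_on_const: "smooth_on S (\<lambda>x. c)"
  unfolding smooth_on_def using Ck_on_const by blast

lemma smooth_on_add: "open S \<Longrightarrow> smooth_on S f \<Longrightarrow> smooth_on S g \<Longrightarrow> smooth_on S (\<lambda>x. f x + g x)"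
  unfolding smooth_on_def using Ck_on_add by blast

lemma smooth_on_bounded_linear: "open S \<Longrightarrow> bounded_linear h \<Longrightarrow> smooth_on S f \<Longrightarrow> smooth_on S (\<lambda>x. h (f x))"
  unfolding smooth_on_def using Ck_on_bounded_linear by blast

lemma smooth_on_bounded_bilinear:
  "open S \<Longrightarrow> bounded_bilinear h \<Longrightarrow> smooth_on S f \<Longrightarrow> smooth_on S g \<Longrightarrow> smooth_on S (\<lambda>x. h (f x) (g x))"
  unfolding smooth_on_def using Ck_on_bounded_bilinear by blast

lemma smooth_on_mult:
  fixes f :: "_ \<Rightarrow> 'c::real_normed_algebra"
  shows "open S \<Longrightarrow> smooth_on S f \<Longrightarrow> smooth_on S g \<Longrightarrow> smooth_on S (\<lambda>x. f x * g x)"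
  using smooth_on_bounded_bilinear[OF _ bounded_bilinear_mult] .

lemma smooth_on_minus: "open S \<Longrightarrow> smooth_on S f \<Longrightarrow> smooth_on S (\<lambda>x. - f x)"
  using smooth_on_bounded_linear[OF _ bounded_linear_minus[OF bounded_linear_ident]] .

lemma smooth_on_diff: "open S \<Longrightarrow> smooth_on S f \<Longrightarrow> smooth_on S g \<Longrightarrow> smooth_on S (\<lambda>x. f x - g x)"
  using smooth_on_add[OF _ _ smooth_on_minus, of S f g] by simp

lemma smooth_on_sum: "open S \<Longrightarrow> (\<And>i. i \<in> I \<Longrightarrow> smooth_on S (f i)) \<Longrightarrow> smooth_on S (\<lambda>x. \<Sum>i\<in>I. f i x)"
  unfolding smooth_on_def by (simp add: Ck_on_sum)

lemma smooth_on_inverse: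
  fixes f :: "_ \<Rightarrow> 'c::real_normed_field"
  shows "open S \<Longrightarrow> smooth_on S f \<Longrightarrow> (\<And>x. x \<in> S \<Longrightarrow> f x \<noteq> 0) \<Longrightarrow> smooth_on S (\<lambda>x. inverse (f x))"
  unfolding smooth_on_def by (simp add: Ck_on_inverse)

lemma smooth_on_divide:
  fixes f :: "_ \<Rightarrow> 'c::real_normed_field"
  shows "open S \<Longrightarrow> smooth_on S f \<Longrightarrow> smooth_on S g \<Longrightarrow> (\<And>x. x \<in> S \<Longrightarrow> g x \<noteq> 0) \<Longrightarrow> smooth_on S (\<lambda>x. f x / g x)"
  unfolding divide_inverse using smooth_on_inverse smooth_on_mult by blast

lemma smooth_on_compose:
  fixes f :: "'a::real_normed_vector \<Rightarrow> 'b::euclidean_space"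
  shows "open S \<Longrightarrow> open T \<Longrightarrow> f ` S \<subseteq> T \<Longrightarrow> smooth_on S f \<Longrightarrow> smooth_on T g \<Longrightarrow> smooth_on S (\<lambda>x. g (f x))"
  unfolding smooth_on_def using Ck_on_compose by blast

lemma smooth_on_has_derivative:
  "smooth_on S f \<Longrightarrow> x \<in> S \<Longrightarrow> (f has_derivative frechet_derivative f (at x)) (at x)"
  unfolding smooth_on_def using Ck_on_SucD by blast

lemma smooth_on_differentiable: "smooth_on S f \<Longrightarrow> x \<in> S \<Longrightarrow> f differentiable (at x)"
  using smooth_on_has_derivative by (auto simp: differentiable_def)

lemma smooth_on_derivative: "smooth_on S f \<Longrightarrow> smooth_on S (\<lambda>x. frechet_derivative f (at x) v)"
  unfolding smooth_on_def
proof
  fix k assume "\<forall>k. Ck_on k S f"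
  then have "Ck_on (Suc k) S f" by blast
  then show "Ck_on k S (\<lambda>x. frechet_derivative f (at x) v)" by simp
qed

lemma smooth_on_continuous: "smooth_on S f \<Longrightarrow> continuous_on S f"
  unfolding smooth_on_def by (metis Ck_on.simps(1))

section \<open>Symmetry of second derivatives\<close>

text \<open>The second difference of \<open>f\<close> over a small parallelogram is symmetric in its two directions. Two
applications of the mean value theorem express it by a second derivative at a nearby point.\<close>

lemma mvt_double_difference:
  fixes f :: "'a::real_normed_vector \<Rightarrow> real"
  assumes h: "0 < h" and S: "\<And>s t. 0 \<le> s \<Longrightarrow> s \<le> h \<Longrightarrow> 0 \<le> t \<Longrightarrow> t \<le> h \<Longrightarrow> x + s *\<^sub>R u + t *\<^sub>R v \<in> S"
    and f: "\<And>y. y \<in> S \<Longrightarrow> f differentiable (at y)"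
    and f2: "\<And>y. y \<in> S \<Longrightarrow> (\<lambda>z. frechet_derivative f (at z) u) differentiable (at y)"
  shows "\<exists>s t. 0 \<le> s \<and> s \<le> h \<and> 0 \<le> t \<and> t \<le> h \<and>
    f (x + h *\<^sub>R u + h *\<^sub>R v) - f (x + h *\<^sub>R u) - f (x + h *\<^sub>R v) + f x
     = h * (h * frechet_derivative (\<lambda>z. frechet_derivative f (at z) u) (at (x + s *\<^sub>R u + t *\<^sub>R v)) v)"
proof -
  let ?F = "\<lambda>y. frechet_derivative f (at y)"
  define phi where "phi = (\<lambda>s. f (x + s *\<^sub>R u + h *\<^sub>R v) - f (x + s *\<^sub>R u))"
  have df: "(f has_derivative ?F y) (at y)" if "y \<in> S" for y
    using f[OF that] frechet_derivative_works by blast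
  have lin: "linear (?F y)" if "y \<in> S" for y using df[OF that] has_derivative_linear by blast
  have d1: "(phi has_real_derivative ?F (x + s *\<^sub>R u + h *\<^sub>R v) u - ?F (x + s *\<^sub>R u) u) (at s)"
    if "0 \<le> s" "s \<le> h" for s
  proof -
    have y: "x + s *\<^sub>R u + h *\<^sub>R v \<in> S" "x + s *\<^sub>R u \<in> S"
      using S[of s h] S[of s 0] that h by auto
    have "(phi has_derivative (\<lambda>r. ?F (x + s *\<^sub>R u + h *\<^sub>R v) (r *\<^sub>R u) - ?F (x + s *\<^sub>R u) (r *\<^sub>R u))) (at s)"
      unfolding phi_def
      by (intro has_derivative_diff
        has_derivative_compose[where g=f and f="\<lambda>s. x + s *\<^sub>R u + h *\<^sub>R v" and x=s, OF _ df[OF y(1)]]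
        has_derivative_compose[where g=f and f="\<lambda>s. x + s *\<^sub>R u" and x=s, OF _ df[OF y(2)]])
       (auto intro!: derivative_eq_intros)
    then show ?thesis unfolding has_field_derivative_def
      by (rule has_derivative_eq_rhs)
        (auto simp: linear_cmul[OF lin[OF y(1)]] linear_cmul[OF lin[OF y(2)]] right_diff_distrib mult.commute fun_eq_iff)
  qed
  obtain s where s: "0 < s" "s < h" "phi h - phi 0 = (h - 0) * (?F (x + s *\<^sub>R u + h *\<^sub>R v) u - ?F (x + s *\<^sub>R u) u)"
    using MVT2[OF h, of phi "\<lambda>s. ?F (x + s *\<^sub>R u + h *\<^sub>R v) u - ?F (x + s *\<^sub>R u) u"] d1 by blast
  let ?G = "\<lambda>y. frechet_derivative (\<lambda>z. ?F z u) (at y)"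
  have d2: "((\<lambda>t. ?F (x + s *\<^sub>R u + t *\<^sub>R v) u) has_real_derivative ?G (x + s *\<^sub>R u + t *\<^sub>R v) v) (at t)"
    if "0 \<le> t" "t \<le> h" for t
  proof -
    have y: "x + s *\<^sub>R u + t *\<^sub>R v \<in> S" using S[of s t] that s by auto
    have dG: "((\<lambda>z. ?F z u) has_derivative ?G (x + s *\<^sub>R u + t *\<^sub>R v)) (at (x + s *\<^sub>R u + t *\<^sub>R v))"
      using f2[OF y] frechet_derivative_works by blast
    have "((\<lambda>t. ?F (x + s *\<^sub>R u + t *\<^sub>R v) u) has_derivative (\<lambda>r. ?G (x + s *\<^sub>R u + t *\<^sub>R v) (r *\<^sub>R v))) (at t)"
      by (rule has_derivative_compose[where g="\<lambda>z. ?F z u" and f="\<lambda>t. x + s *\<^sub>R u + t *\<^sub>R v" and x=t, OF _ dG])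
       (auto intro!: derivative_eq_intros)
    then show ?thesis unfolding has_field_derivative_def
      by (rule has_derivative_eq_rhs)
        (auto simp: linear_cmul[OF has_derivative_linear[OF dG]] mult.commute fun_eq_iff)
  qed
  obtain t where t: "0 < t" "t < h" "?F (x + s *\<^sub>R u + h *\<^sub>R v) u - ?F (x + s *\<^sub>R u + 0 *\<^sub>R v) u = (h - 0) * ?G (x + s *\<^sub>R u + t *\<^sub>R v) v"
    using MVT2[OF h, of "\<lambda>t. ?F (x + s *\<^sub>R u + t *\<^sub>R v) u" "\<lambda>t. ?G (x + s *\<^sub>R u + t *\<^sub>R v) v"] d2 by blast
  show ?thesis
    using s t by (intro exI[of _ s] exI[of _ t]) (auto simp: phi_def)
qed

text \<open>Both orders of differentiation compute the same second difference, at points that tend to \<open>x\<close> as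
the parallelogram shrinks; continuity of the second derivatives does the rest.\<close>

lemma second_derivative_symmetric_real:
  fixes f :: "'a::real_normed_vector \<Rightarrow> real"
  assumes S: "open S" "x \<in> S" and f: "Ck_on 2 S f"
  shows "frechet_derivative (\<lambda>z. frechet_derivative f (at z) u) (at x) v
       = frechet_derivative (\<lambda>z. frechet_derivative f (at z) v) (at x) u"
proof -
  define G where "G = (\<lambda>u v y. frechet_derivative (\<lambda>z. frechet_derivative f (at z) u) (at y) v)"
  have f': "Ck_on (Suc (Suc 0)) S f" using f by (simp only: numeral_2_eq_2)
  have cont: "continuous_on S (G u v)" for u v using f' unfolding G_def by simp
  have d1: "f differentiable (at y)" if "y \<in> S" for y using f' that by simp
  have d2: "(\<lambda>z. frechet_derivative f (at z) w) differentiable (at y)" if "y \<in> S" for y w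
    using f' that by simp
  have "dist (G u v x) (G v u x) < e" if e: "e > 0" for e
  proof -
    have "isCont (G u v) x" "isCont (G v u) x"
      using cont S continuous_on_eq_continuous_at by blast+
    then obtain d1' d2' where dd: "d1' > 0" "d2' > 0"
       "\<And>y. dist y x < d1' \<Longrightarrow> dist (G u v y) (G u v x) < e/2"
       "\<And>y. dist y x < d2' \<Longrightarrow> dist (G v u y) (G v u x) < e/2"
      unfolding continuous_at_eps_delta using e by (metis half_gt_zero)
    obtain d0 where d0: "d0 > 0" "ball x d0 \<subseteq> S" using S open_contains_ball by blast
    define d where "d = min d0 (min d1' d2')"
    have d: "d > 0" using dd d0 by (auto simp: d_def)
    \<comment> \<open>Small enough for the whole parallelogram to lie within distance \<open>d\<close> of \<open>x\<close>; the \<open>1\<close> keeps the denominator positive.\<close>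
    define h where "h = d / (2 * (norm u + norm v + 1))"
    have n0: "norm u + norm v + 1 > 0" by (smt (verit) norm_ge_zero)
    have h: "h > 0" using d n0 by (simp add: h_def)
    have small: "dist (x + s *\<^sub>R u + t *\<^sub>R v) x < d" if "0 \<le> s" "s \<le> h" "0 \<le> t" "t \<le> h" for s t
    proof -
      have "norm (s *\<^sub>R u + t *\<^sub>R v) \<le> s * norm u + t * norm v"
        using norm_triangle_ineq[of "s *\<^sub>R u" "t *\<^sub>R v"] that by simp
      also have "\<dots> \<le> h * norm u + h * norm v" using that by (intro add_mono mult_right_mono) auto
      also have "\<dots> < h * (norm u + norm v + 1)" using h by (simp add: algebra_simps)
      also have "\<dots> = d / 2" using n0 unfolding h_def by (simp add: field_simps)
      finally show ?thesis using d by (simp add: dist_norm add.assoc)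
    qed
    have inS: "x + s *\<^sub>R u + t *\<^sub>R v \<in> S" if "0 \<le> s" "s \<le> h" "0 \<le> t" "t \<le> h" for s t
      using small[OF that] d0 by (auto simp: d_def dist_commute)
    have inS': "x + s *\<^sub>R v + t *\<^sub>R u \<in> S" if "0 \<le> s" "s \<le> h" "0 \<le> t" "t \<le> h" for s t
      using inS[OF that(3,4,1,2)] by (simp add: algebra_simps)
    obtain s t where 1: "0 \<le> s" "s \<le> h" "0 \<le> t" "t \<le> h"
      "f (x + h *\<^sub>R u + h *\<^sub>R v) - f (x + h *\<^sub>R u) - f (x + h *\<^sub>R v) + f x = h * (h * G u v (x + s *\<^sub>R u + t *\<^sub>R v))"
      using mvt_double_difference[OF h, of x u v S f, OF inS d1 d2] unfolding G_def by blast
    obtain s' t' where 2: "0 \<le> s'" "s' \<le> h" "0 \<le> t'" "t' \<le> h"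
      "f (x + h *\<^sub>R v + h *\<^sub>R u) - f (x + h *\<^sub>R v) - f (x + h *\<^sub>R u) + f x = h * (h * G v u (x + s' *\<^sub>R v + t' *\<^sub>R u))"
      using mvt_double_difference[OF h, of x v u S f, OF inS' d1 d2] unfolding G_def by blast
    have "x + h *\<^sub>R u + h *\<^sub>R v = x + h *\<^sub>R v + h *\<^sub>R u" by (simp add: algebra_simps)
    with 1(5) 2(5) have "h * (h * G u v (x + s *\<^sub>R u + t *\<^sub>R v)) = h * (h * G v u (x + s' *\<^sub>R v + t' *\<^sub>R u))"
      by (simp only:)
    then have eq: "G u v (x + s *\<^sub>R u + t *\<^sub>R v) = G v u (x + t' *\<^sub>R u + s' *\<^sub>R v)"
      using h by (simp add: algebra_simps)
    have "dist (G u v (x + s *\<^sub>R u + t *\<^sub>R v)) (G u v x) < e/2"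
      using small[OF 1(1-4)] by (intro dd) (auto simp: d_def)
    moreover have "dist (G v u (x + t' *\<^sub>R u + s' *\<^sub>R v)) (G v u x) < e/2"
      using small[OF 2(3,4,1,2)] by (intro dd) (auto simp: d_def)
    ultimately show ?thesis unfolding eq
      by (metis dist_commute dist_triangle_half_r)
  qed
  then have "G u v x = G v u x" by (metis dist_self less_irrefl zero_less_dist_iff)
  then show ?thesis by (simp add: G_def)
qed

lemma frechet_derivative_bounded_linear:
  assumes "bounded_linear h" "f differentiable (at x)"
  shows "frechet_derivative (\<lambda>y. h (f y)) (at x) = (\<lambda>v. h (frechet_derivative f (at x) v))"
  using bounded_linear.has_derivative[OF assms(1)] assms(2) frechet_derivative_works
    frechet_derivative_at by metis

lemma second_derivative_symmetric:
  fixes f :: "'a::real_normed_vector \<Rightarrow> 'b::euclidean_space"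
  assumes S: "open S" "x \<in> S" and f: "smooth_on S f"
  shows "frechet_derivative (\<lambda>z. frechet_derivative f (at z) u) (at x) v
       = frechet_derivative (\<lambda>z. frechet_derivative f (at z) v) (at x) u"
proof (rule euclidean_eqI)
  fix b :: 'b assume "b \<in> Basis"
  have bl: "bounded_linear (\<lambda>w. w \<bullet> b)" by (rule bounded_linear_inner_left)
  have fb: "smooth_on S (\<lambda>x. f x \<bullet> b)" using smooth_on_bounded_linear[OF S(1) bl f] .
  have e: "frechet_derivative (\<lambda>z. frechet_derivative f (at z) u) (at x) v \<bullet> b
     = frechet_derivative (\<lambda>z. frechet_derivative (\<lambda>z. f z \<bullet> b) (at z) u) (at x) v" for u v
  proof -
    have "frechet_derivative (\<lambda>z. frechet_derivative f (at z) u) (at x) v \<bullet> b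
       = frechet_derivative (\<lambda>z. frechet_derivative f (at z) u \<bullet> b) (at x) v"
      using frechet_derivative_bounded_linear[OF bl smooth_on_differentiable[OF smooth_on_derivative[OF f] S(2)]] by metis
    also have "frechet_derivative (\<lambda>z. frechet_derivative f (at z) u \<bullet> b) (at x)
      = frechet_derivative (\<lambda>z. frechet_derivative (\<lambda>z. f z \<bullet> b) (at z) u) (at x)"
      by (rule frechet_derivative_cong_open[OF S])
       (use frechet_derivative_bounded_linear[OF bl smooth_on_differentiable[OF f]] in metis)
    finally show ?thesis .
  qed
  show "frechet_derivative (\<lambda>z. frechet_derivative f (at z) u) (at x) v \<bullet> b =
        frechet_derivative (\<lambda>z. frechet_derivative f (at z) v) (at x) u \<bullet> b"
    unfolding e using second_derivative_symmetric_real[OF S] fb unfolding smooth_on_def by blast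
qed

section \<open>Smooth bump functions\<close>

text \<open>The functions \<open>t\<^sup>-\<^sup>n exp (- 1/t)\<close>, extended by \<open>0\<close> to \<open>t \<le> 0\<close>. Taking all \<open>n\<close> at once gives a family
whose span is closed under differentiation.\<close>

definition flat_exp :: "nat \<Rightarrow> real \<Rightarrow> real" where
  "flat_exp n t = (if t > 0 then inverse t ^ n * exp (- inverse t) else 0)"

lemma flat_exp_tendsto_0: "(flat_exp n \<longlongrightarrow> 0) (at 0)"
proof -
  have "((\<lambda>t. inverse t ^ n / exp (inverse t)) \<longlongrightarrow> 0) (at_right (0::real))"
    by (rule filterlim_compose[OF tendsto_power_div_exp_0 filterlim_inverse_at_top_right])
  then have "(flat_exp n \<longlongrightarrow> 0) (at_right 0)"
    by (rule Lim_transform_eventually)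
      (auto simp: flat_exp_def exp_minus divide_inverse eventually_at_filter)
  moreover have "(flat_exp n \<longlongrightarrow> 0) (at_left 0)"
    by (rule Lim_transform_eventually[OF tendsto_const])
      (auto simp: flat_exp_def eventually_at_filter)
  ultimately show ?thesis by (simp add: filterlim_at_split)
qed

lemma flat_exp_derivative:
  "(flat_exp n has_real_derivative flat_exp (n+2) t - real n * flat_exp (n+1) t) (at t)"
proof -
  consider "t > 0" | "t < 0" | "t = 0" by linarith
  then show ?thesis
  proof cases
    case 1
    have "((\<lambda>t. inverse t ^ n * exp (- inverse t)) has_real_derivative flat_exp (n+2) t - real n * flat_exp (n+1) t) (at t)"
    proof -
      have i: "(inverse has_real_derivative - (inverse t)\<^sup>2) (at t)"
        using DERIV_inverse[of t] 1 by (simp add: power2_eq_square)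
      have e: "((\<lambda>t. exp (- inverse t)) has_real_derivative exp (- inverse t) * (inverse t)\<^sup>2) (at t)"
        using DERIV_chain2[OF DERIV_exp DERIV_minus[OF i]] by simp
      have p: "((\<lambda>t. inverse t ^ n) has_real_derivative - (real n * inverse t ^ (n + 1))) (at t)"
      proof (cases n)
        case (Suc m)
        show ?thesis using DERIV_power_Suc[OF i, of m] by (simp add: Suc power2_eq_square algebra_simps)
      qed simp
      show ?thesis
        by (rule DERIV_cong[OF DERIV_mult[OF p e]]) (use 1 in \<open>simp add: flat_exp_def power2_eq_square algebra_simps\<close>)
    qed
    then show ?thesis
      by (rule has_field_derivative_transform_within_open[where S="{0<..}"]) (use 1 in \<open>auto simp: flat_exp_def\<close>)
  next
    case 2
    have "((\<lambda>t. 0) has_real_derivative flat_exp (n+2) t - real n * flat_exp (n+1) t) (at t)"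
      using 2 by (auto simp: flat_exp_def)
    then show ?thesis
      by (rule has_field_derivative_transform_within_open[where S="{..<0}"]) (use 2 in \<open>auto simp: flat_exp_def\<close>)
  next
    case 3
    have "((\<lambda>h. (flat_exp n (0 + h) - flat_exp n 0) / h) \<longlongrightarrow> 0) (at 0)"
      by (rule Lim_transform_eventually[OF flat_exp_tendsto_0[of "Suc n"]])
        (auto simp: flat_exp_def divide_inverse eventually_at_filter)
    then show ?thesis using 3 by (simp add: DERIV_def flat_exp_def)
  qed
qed

text \<open>The derivative of a member of the family is a combination of two other members, so induction on the
order of differentiability applies to all of them simultaneously.\<close>

lemma smooth_on_flat_exp: "smooth_on UNIV (flat_exp n)"
proof -
  have cont: "continuous_on UNIV (flat_exp n)" for n
    by (meson DERIV_isCont continuous_at_imp_continuous_on flat_exp_derivative)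
  have "Ck_on k UNIV (flat_exp n)" for k
  proof (induction k arbitrary: n)
    case 0 then show ?case using cont by simp
  next
    case (Suc k)
    show ?case
    proof (rule Ck_on_SucI[where F="\<lambda>t v. (flat_exp (n+2) t - real n * flat_exp (n+1) t) * v"])
      show "(flat_exp n has_derivative (\<lambda>v. (flat_exp (n+2) t - real n * flat_exp (n+1) t) * v)) (at t)" for t
        using flat_exp_derivative[of n t] by (simp add: has_field_derivative_def)
      have "Ck_on k UNIV (\<lambda>t. (flat_exp (n+2) t + (- real n) * flat_exp (n+1) t) * v)" for v
        by (intro Ck_on_bounded_bilinear[OF _ bounded_bilinear_mult] Ck_on_add Ck_on_const Suc) auto
      then show "Ck_on k UNIV (\<lambda>t. (flat_exp (n+2) t - real n * flat_exp (n+1) t) * v)" for v by simp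
    qed simp
  qed
  then show ?thesis by (simp add: smooth_on_def)
qed

lemma smooth_on_ident: "open S \<Longrightarrow> smooth_on S (\<lambda>x. x)"
proof -
  assume S: "open S"
  have "Ck_on k S (\<lambda>x. x)" for k
  proof (cases k)
    case (Suc m) then show ?thesis by (auto intro!: Ck_on_SucI[OF S, where F="\<lambda>x v. v"] Ck_on_const)
  qed auto
  then show ?thesis by (simp add: smooth_on_def)
qed

text \<open>Positive exactly on the open ball of radius \<open>r\<close> about \<open>a\<close>, for \<open>r > 0\<close>.\<close>

definition bump :: "'a::real_inner \<Rightarrow> real \<Rightarrow> 'a \<Rightarrow> real" where
  "bump a r x = flat_exp 0 (r\<^sup>2 - (x - a) \<bullet> (x - a))"

lemma smooth_on_bump: "smooth_on UNIV (bump a r)"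
proof -
  have "smooth_on UNIV (\<lambda>x. r\<^sup>2 - (x - a) \<bullet> (x - a))"
    by (intro smooth_on_diff smooth_on_const smooth_on_bounded_bilinear[OF _ bounded_bilinear_inner] smooth_on_ident) auto
  then show ?thesis unfolding bump_def
    by (rule smooth_on_compose[where T=UNIV, rotated 3]) (auto simp: smooth_on_flat_exp)
qed

lemma bump_nonneg: "bump a r x \<ge> 0"
  by (simp add: bump_def flat_exp_def)

lemma bump_pos_iff: "r > 0 \<Longrightarrow> bump a r x > 0 \<longleftrightarrow> x \<in> ball a r"
  by (auto simp: bump_def flat_exp_def dist_norm norm_minus_commute power2_norm_eq_inner[symmetric]
     intro: power_strict_mono dest: power_less_imp_less_base)

section \<open>Charts and transition maps\<close>

lemma is_chartD:
  assumes "is_chart c"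
  shows chart_open_dom: "open (chart_dom c)" and chart_open_img: "open (chart_img c)"
    and chart_continuous_coord: "continuous_on (chart_dom c) (coord c)"
    and chart_continuous_param: "continuous_on (chart_img c) (param c)"
    and chart_param_coord: "p \<in> chart_dom c \<Longrightarrow> param c (coord c p) = p"
    and chart_coord_param: "x \<in> chart_img c \<Longrightarrow> coord c (param c x) = x"
    and chart_coord_in: "p \<in> chart_dom c \<Longrightarrow> coord c p \<in> chart_img c"
    and chart_param_in: "x \<in> chart_img c \<Longrightarrow> param c x \<in> chart_dom c"
  using assms unfolding is_chart_def homeomorphism_def by auto

lemma overlap_eq:
  assumes "is_chart c"
  shows "overlap c d = {x \<in> chart_img c. param c x \<in> chart_dom d}"
proof (intro equalityI subsetI)
  fix x assume "x \<in> {x \<in> chart_img c. param c x \<in> chart_dom d}"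
  then show "x \<in> overlap c d" unfolding overlap_def
    using chart_coord_param[OF assms, of x] chart_param_in[OF assms, of x] by (metis (no_types, lifting) IntI image_eqI mem_Collect_eq)
qed (auto simp: overlap_def chart_param_coord[OF assms] chart_coord_in[OF assms])

lemma overlap_subset: "is_chart c \<Longrightarrow> overlap c d \<subseteq> chart_img c"
  by (auto simp: overlap_eq)

lemma open_chart_preimage:
  assumes "is_chart c" "open U"
  shows "open {x \<in> chart_img c. param c x \<in> U}"
  using continuous_open_preimage[OF chart_continuous_param chart_open_img] assms
  by (simp add: vimage_def Int_def)

lemma open_overlap:
  assumes "is_chart c" "is_chart d"
  shows "open (overlap c d)"
  using open_chart_preimage[OF assms(1) chart_open_dom[OF assms(2)]] by (simp add: overlap_eq[OF assms(1)])

lemma transition_in_overlap: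
  assumes "is_chart c" "is_chart d" "x \<in> overlap c d"
  shows "transition c d x \<in> overlap d c"
  using assms by (auto simp: overlap_eq transition_def is_chartD)

lemma transition_inverse:
  assumes "is_chart c" "is_chart d" "x \<in> overlap c d"
  shows "transition d c (transition c d x) = x"
  using assms by (auto simp: overlap_eq transition_def is_chartD)

lemma param_transition:
  assumes "is_chart c" "is_chart d" "x \<in> overlap c d"
  shows "param d (transition c d x) = param c x"
  using assms by (auto simp: overlap_eq transition_def is_chartD)

lemma oriented_atlasD:
  assumes "oriented_atlas M"
  shows atlas_is_chart: "c \<in> M \<Longrightarrow> is_chart c"
    and atlas_cover: "\<exists>c\<in>M. p \<in> chart_dom c"
    and atlas_smooth: "c \<in> M \<Longrightarrow> d \<in> M \<Longrightarrow> smooth_on (overlap c d) (transition c d)"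
    and atlas_det: "c \<in> M \<Longrightarrow> d \<in> M \<Longrightarrow> x \<in> overlap c d \<Longrightarrow> det (jacobian (transition c d) (at x)) > 0"
  using assms unfolding oriented_atlas_def by auto

section \<open>Smooth partitions of unity\<close>

definition chart_bump :: "'a chart \<Rightarrow> real^3 \<Rightarrow> real \<Rightarrow> 'a \<Rightarrow> real" where
  "chart_bump c a r q = (if q \<in> chart_dom c then bump a r (coord c q) else 0)"

lemma chart_bump_support:
  assumes "is_chart c" "r > 0" "chart_bump c a r q \<noteq> 0"
  shows "q \<in> param c ` cball a r"
proof -
  have q: "q \<in> chart_dom c" "bump a r (coord c q) > 0"
    using assms(3) bump_nonneg[of a r "coord c q"] by (auto simp: chart_bump_def split: if_splits)
  then have "coord c q \<in> cball a r" using bump_pos_iff[OF assms(2), of a "coord c q"] by simp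
  then show ?thesis using chart_param_coord[OF assms(1) q(1)] by (metis imageI)
qed

text \<open>In a Hausdorff space this makes the support of a chart bump closed, not only relatively closed in
the chart domain, which is what the extension by zero requires.\<close>

lemma compact_chart_ball:
  assumes "is_chart c" "cball a r \<subseteq> chart_img c"
  shows "compact (param c ` cball a r)"
  by (meson assms chart_continuous_param compact_cball compact_continuous_image continuous_on_subset)

text \<open>Where the chart \<open>d\<close> meets \<open>c\<close>, the function is a bump composed with a transition map; away from the
compact support it is zero. These two open sets cover the image of \<open>d\<close>.\<close>

lemma smooth_chart_bump:
  fixes M :: "'a::t2_space chart set"
  assumes M: "oriented_atlas M" and c: "c \<in> M" and d: "d \<in> M" and r: "r > 0" and img: "cball a r \<subseteq> chart_img c"
  shows "smooth_on (chart_img d) (chart_bump c a r \<circ> param d)"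
proof -
  have ch: "is_chart c" "is_chart d" using M c d atlas_is_chart by blast+
  let ?K = "param c ` cball a r"
  let ?T = "{x \<in> chart_img d. param d x \<in> - ?K}"
  have "open (- ?K)" using compact_chart_ball[OF ch(1) img] compact_imp_closed by auto
  then have oT: "open ?T" using open_chart_preimage[OF ch(2)] by blast
  have oS: "open (overlap d c)" using open_overlap ch by blast
  have "smooth_on (overlap d c) (\<lambda>x. bump a r (transition d c x))"
    by (rule smooth_on_compose[OF oS open_UNIV _ atlas_smooth[OF M d c] smooth_on_bump]) simp
  then have s1: "smooth_on (overlap d c) (chart_bump c a r \<circ> param d)"
    by (subst smooth_on_cong[OF oS]) (auto simp: chart_bump_def overlap_eq[OF ch(2)] transition_def)
  have s2: "smooth_on ?T (chart_bump c a r \<circ> param d)"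
    by (subst smooth_on_cong[OF oT, where g="\<lambda>x. 0"]) (use chart_bump_support[OF ch(1) r] in \<open>auto simp: smooth_on_const\<close>)
  have "?K \<subseteq> chart_dom c" using img chart_param_in[OF ch(1)] by auto
  then have "chart_img d = overlap d c \<union> ?T" by (auto simp: overlap_eq[OF ch(2)])
  then show ?thesis using smooth_on_Un[OF oS oT s1 s2] by simp
qed

text \<open>Finitely many coordinate balls cover the compact manifold; the bumps on them are normalised by their
sum. The partition is indexed by charts, so bumps that live in the same chart are added up.\<close>

lemma partition_of_unity_exists:
  fixes M :: "'a::t2_space chart set"
  assumes M: "oriented_atlas M" and comp: "compact (UNIV :: 'a set)"
  shows "\<exists>F \<rho>. partition_of_unity M F \<rho>"
proof -
  have "\<exists>c r. c \<in> M \<and> p \<in> chart_dom c \<and> r > 0 \<and> cball (coord c p) r \<subseteq> chart_img c" for p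
  proof -
    obtain c where c: "c \<in> M" "p \<in> chart_dom c" using atlas_cover[OF M] by blast
    have "is_chart c" using c atlas_is_chart[OF M] by blast
    from chart_open_img[OF this] chart_coord_in[OF this c(2)]
    obtain r where "r > 0" "cball (coord c p) r \<subseteq> chart_img c" using open_contains_cball by blast
    with c show ?thesis by blast
  qed
  then obtain cc rr where cr: "\<And>p. cc p \<in> M" "\<And>p. p \<in> chart_dom (cc p)" "\<And>p. rr p > 0"
     "\<And>p. cball (coord (cc p) p) (rr p) \<subseteq> chart_img (cc p)" by metis
  have ch: "is_chart (cc p)" for p using cr(1) M atlas_is_chart by blast
  define U where "U p = {q \<in> chart_dom (cc p). coord (cc p) q \<in> ball (coord (cc p) p) (rr p)}" for p
  have oU: "open (U p)" for p
    using continuous_open_preimage[OF chart_continuous_coord[OF ch] chart_open_dom[OF ch] open_ball]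
    unfolding U_def by (simp add: vimage_def Int_def del: mem_ball)
  have "p \<in> U p" for p using cr by (simp add: U_def)
  then have cover: "UNIV \<subseteq> (\<Union>p\<in>UNIV. U p)" by blast
  obtain P where P: "finite P" "UNIV \<subseteq> (\<Union>p\<in>P. U p)"
    by (rule compactE_image[OF comp oU cover])
  define f where "f p = chart_bump (cc p) (coord (cc p) p) (rr p)" for p
  define K where "K p = param (cc p) ` cball (coord (cc p) p) (rr p)" for p
  define s where "s q = (\<Sum>p\<in>P. f p q)" for q
  define \<rho> where "\<rho> c q = (\<Sum>p\<in>{p\<in>P. cc p = c}. f p q) / s q" for c q
  have f0: "f p q \<ge> 0" for p q by (simp add: f_def chart_bump_def bump_nonneg)
  have fU: "f p q > 0" if "q \<in> U p" for p q
    using that bump_pos_iff[OF cr(3)] by (auto simp: f_def U_def chart_bump_def)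
  have spos: "s q > 0" for q
  proof -
    obtain p where "p \<in> P" "q \<in> U p" using P by blast
    then show ?thesis unfolding s_def using fU f0 P(1) by (intro sum_pos2) auto
  qed
  have smf: "smooth_on (chart_img d) (\<lambda>x. f p (param d x))" if "d \<in> M" for d p
    using smooth_chart_bump[OF M cr(1) that cr(3,4)] by (simp add: f_def o_def)
  have "finite (cc ` P)" "cc ` P \<subseteq> M" using P cr by auto
  moreover have "smooth_on (chart_img d) (\<rho> c \<circ> param d)" if "d \<in> M" for c d
  proof -
    have "open (chart_img d)" using chart_open_img atlas_is_chart[OF M that] by blast
    moreover have "(\<Sum>p\<in>P. f p q) \<noteq> 0" for q using spos[of q] by (simp add: s_def)
    ultimately show ?thesis unfolding \<rho>_def o_def s_def
      by (intro smooth_on_divide smooth_on_sum smf that) auto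
  qed
  moreover have "\<rho> c q \<ge> 0" for c q unfolding \<rho>_def using f0 spos[of q] by (simp add: sum_nonneg)
  moreover have "closure {q. \<rho> c q \<noteq> 0} \<subseteq> chart_dom c" for c
  proof -
    let ?C = "\<Union>p\<in>{p\<in>P. cc p = c}. K p"
    have "compact (K p)" for p unfolding K_def using compact_chart_ball[OF ch cr(4)] .
    then have "closed ?C" using P by (intro closed_UN) (auto intro: compact_imp_closed)
    moreover have "{q. \<rho> c q \<noteq> 0} \<subseteq> ?C"
    proof
      fix q assume "q \<in> {q. \<rho> c q \<noteq> 0}"
      then have "(\<Sum>p\<in>{p\<in>P. cc p = c}. f p q) \<noteq> 0" by (auto simp: \<rho>_def)
      then obtain p where "p \<in> P" "cc p = c" "f p q \<noteq> 0"
        by (elim sum.not_neutral_contains_not_neutral) auto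
      then show "q \<in> ?C" using chart_bump_support[OF ch cr(3)] by (auto simp: f_def K_def)
    qed
    ultimately have "closure {q. \<rho> c q \<noteq> 0} \<subseteq> ?C" using closure_minimal by blast
    also have "?C \<subseteq> chart_dom c" using cr(4) chart_param_in[OF ch] by (auto simp: K_def)
    finally show ?thesis .
  qed
  moreover have "(\<Sum>c\<in>cc ` P. \<rho> c q) = 1" for q
  proof -
    have "(\<Sum>c\<in>cc ` P. \<rho> c q) = (\<Sum>c\<in>cc ` P. (\<Sum>p\<in>{p\<in>P. cc p = c}. f p q)) / s q"
      by (simp add: \<rho>_def sum_divide_distrib)
    also have "\<dots> = 1" using sum.image_gen[OF P(1), of "\<lambda>p. f p q" cc] spos[of q] by (simp add: s_def)
    finally show ?thesis .
  qed
  ultimately have "partition_of_unity M (cc ` P) \<rho>" unfolding partition_of_unity_def by auto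
  then show ?thesis by blast
qed

section \<open>Integrals of compactly supported functions\<close>

text \<open>The change of variables formula for vector-valued maps, transported along \<open>\<complex> \<cong> \<real>\<^sup>2\<close>.\<close>

lemma integral_change_of_variables_complex:
  fixes f :: "real^'n::{finite,wellorder} \<Rightarrow> complex" and g :: "real^'n::_ \<Rightarrow> real^'n::_"
  assumes S: "S \<in> sets lebesgue"
    and der: "\<And>x. x \<in> S \<Longrightarrow> (g has_derivative g' x) (at x within S)"
    and inj: "inj_on g S" and f: "f absolutely_integrable_on (g ` S)"
  shows "integral (g ` S) f = integral S (\<lambda>x. \<bar>det (matrix (g' x))\<bar> *\<^sub>R f (g x))"
proof -
  define h :: "complex \<Rightarrow> real^2" where "h z = vector [Re z, Im z]" for z
  define k :: "real^2 \<Rightarrow> complex" where "k v = Complex (v $ 1) (v $ 2)" for v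
  have "linear h" by (rule linearI) (auto simp: h_def vec_eq_iff forall_2)
  then have h: "bounded_linear h" by (simp add: linear_linear)
  have "linear k" by (rule linearI) (auto simp: k_def complex_eq_iff)
  then have k: "bounded_linear k" by (simp add: linear_linear)
  have kh: "k (h z) = z" for z by (simp add: h_def k_def)
  have hf: "(h \<circ> f) absolutely_integrable_on g ` S" by (rule absolutely_integrable_linear[OF f h])
  have eq: "(\<lambda>x. \<bar>det (matrix (g' x))\<bar> *\<^sub>R (h \<circ> f) (g x)) absolutely_integrable_on S \<and>
    integral S (\<lambda>x. \<bar>det (matrix (g' x))\<bar> *\<^sub>R (h \<circ> f) (g x)) = integral (g ` S) (h \<circ> f)"
    using has_absolute_integral_change_of_variables[OF S der inj] hf by blast
  have "integral (g ` S) f = k (integral (g ` S) (h \<circ> f))"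
    using integral_linear[OF set_lebesgue_integral_eq_integral(1)[OF hf] k] by (simp add: o_def kh)
  also have "\<dots> = integral S (k \<circ> (\<lambda>x. \<bar>det (matrix (g' x))\<bar> *\<^sub>R (h \<circ> f) (g x)))"
    using integral_linear[OF set_lebesgue_integral_eq_integral(1)[OF conjunct1[OF eq]] k] conjunct2[OF eq] by simp
  also have "k \<circ> (\<lambda>x. \<bar>det (matrix (g' x))\<bar> *\<^sub>R (h \<circ> f) (g x)) = (\<lambda>x. \<bar>det (matrix (g' x))\<bar> *\<^sub>R f (g x))"
    by (auto simp: fun_eq_iff linear_cmul[OF \<open>linear k\<close>] kh)
  finally show ?thesis .
qed

lemma absolutely_integrable_compact_support:
  fixes f :: "'a::euclidean_space \<Rightarrow> 'b::euclidean_space"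
  assumes "compact K" "K \<subseteq> S" "continuous_on K f" "\<And>x. x \<in> S - K \<Longrightarrow> f x = 0"
  shows "f absolutely_integrable_on S"
proof -
  have "set_integrable lborel K f"
    unfolding set_integrable_def using borel_integrable_compact[OF assms(1,3)] .
  then have "f absolutely_integrable_on K"
    unfolding set_integrable_def using integrable_completion[of "\<lambda>x. indicat_real K x *\<^sub>R f x" lborel]
    by (auto dest: borel_measurable_integrable)
  moreover have "(\<lambda>x. if x \<in> K then f x else 0) = (\<lambda>x. if x \<in> S then f x else 0)"
    using assms(2,4) by (auto simp: fun_eq_iff)
  ultimately show ?thesis
    using absolutely_integrable_restrict_UNIV[of K f] absolutely_integrable_restrict_UNIV[of S f] by simp
qed

lemma integral_cong_support:
  fixes f :: "'a::euclidean_space \<Rightarrow> 'b::banach"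
  assumes "\<And>x. x \<in> S - T \<Longrightarrow> f x = 0" "T \<subseteq> S"
  shows "integral S f = integral T f"
proof -
  have "(\<lambda>x. if x \<in> S then f x else 0) = (\<lambda>x. if x \<in> T then f x else 0)" using assms by (auto simp: fun_eq_iff)
  then show ?thesis by (metis integral_restrict_UNIV)
qed

lemma integral_translate:
  fixes f :: "real^'n::{finite,wellorder} \<Rightarrow> complex"
  assumes "f absolutely_integrable_on UNIV"
  shows "integral UNIV (\<lambda>x. f (x + a)) = integral UNIV f"
proof -
  have r: "range (\<lambda>x::real^'n::{finite,wellorder}. x + a) = UNIV" by (rule surj_plus_right)
  have "integral (range (\<lambda>x. x + a)) f = integral UNIV (\<lambda>x. \<bar>det (matrix (\<lambda>v::real^'n::{finite,wellorder}. v))\<bar> *\<^sub>R f (x + a))"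
    by (rule integral_change_of_variables_complex)
      (use assms r in \<open>auto intro!: derivative_eq_intros simp: inj_on_def\<close>)
  moreover have "det (matrix (\<lambda>v::real^'n::{finite,wellorder}. v)) = 1"
    by (simp add: matrix_id_mat_1[unfolded id_def])
  ultimately show ?thesis by (simp add: r)
qed

text \<open>The integral of \<open>x \<mapsto> F (x + t v)\<close> does not depend on \<open>t\<close>, by translation invariance. Differentiating
under the integral sign at \<open>t = 0\<close> gives the integral of the directional derivative.\<close>

lemma integral_directional_derivative_eq_0:
  fixes F :: "real^'n::{finite,wellorder} \<Rightarrow> complex"
  assumes F: "smooth_on UNIV F" and K: "compact K" "\<And>x. x \<notin> K \<Longrightarrow> F x = 0"
  shows "integral UNIV (\<lambda>x. frechet_derivative F (at x) v) = 0"
proof -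
  have dF: "(F has_derivative frechet_derivative F (at x)) (at x)" for x
    using smooth_on_has_derivative[OF F] by simp
  have cF: "continuous_on UNIV F" "continuous_on UNIV (\<lambda>x. frechet_derivative F (at x) v)"
    using smooth_on_continuous F smooth_on_derivative by blast+
  obtain r where r: "\<And>x. x \<in> K \<Longrightarrow> norm x \<le> r" using K(1) compact_imp_bounded bounded_iff by metis
  \<comment> \<open>A fixed box that contains the supports of all translates by \<open>t v\<close> with \<open>\<bar>t\<bar> \<le> 1\<close>.\<close>
  obtain b where b: "cball (0 :: real^'n::{finite,wellorder}) (r + norm v) \<subseteq> cbox (-b) b"
    using bounded_subset_cbox_symmetric[OF bounded_cball] by blast
  define fx where "fx t x = frechet_derivative F (at (x + t *\<^sub>R v)) v" for t and x :: "real^'n::{finite,wellorder}"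
  have out: "F (x + t *\<^sub>R v) = 0" if "x \<notin> cbox (-b) b" "\<bar>t\<bar> \<le> 1" for x :: "real^'n::{finite,wellorder}" and t
  proof -
    have "\<bar>t\<bar> * norm v \<le> norm v" using that(2) by (simp add: mult_left_le_one_le)
    moreover have "norm x > r + norm v" using that(1) b by (meson mem_cball_0 not_le subsetD)
    moreover have "norm x \<le> norm (x + t *\<^sub>R v) + \<bar>t\<bar> * norm v"
      using norm_triangle_ineq4[of "x + t *\<^sub>R v" "t *\<^sub>R v"] by simp
    ultimately have "norm (x + t *\<^sub>R v) > r" by linarith
    then show ?thesis using r K(2) by force
  qed
  have aiF: "F absolutely_integrable_on UNIV"
    by (rule absolutely_integrable_compact_support[OF K(1)]) (use K cF in \<open>auto intro: continuous_on_subset\<close>)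
  have const: "integral (cbox (-b) b) (\<lambda>x. F (x + t *\<^sub>R v)) = integral UNIV F" if "t \<in> {-1..1}" for t
    using integral_cong_support[of UNIV "cbox (-b) b" "\<lambda>x. F (x + t *\<^sub>R v)"] out that integral_translate[OF aiF] by auto
  have "((\<lambda>t. integral (cbox (-b) b) (\<lambda>x. F (x + t *\<^sub>R v))) has_vector_derivative integral (cbox (-b) b) (fx 0)) (at 0 within {-1..1})"
  proof (rule leibniz_rule_vector_derivative)
    fix t x assume "t \<in> {-1..1::real}"
    have "((\<lambda>t. F (x + t *\<^sub>R v)) has_derivative (\<lambda>s. frechet_derivative F (at (x + t *\<^sub>R v)) (s *\<^sub>R v))) (at t within {-1..1})"
      by (rule has_derivative_compose[where f="\<lambda>t. x + t *\<^sub>R v" and g=F, OF _ dF])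
        (auto intro!: derivative_eq_intros)
    then show "((\<lambda>t. F (x + t *\<^sub>R v)) has_vector_derivative fx t x) (at t within {-1..1})"
      unfolding has_vector_derivative_def fx_def
      by (simp add: linear_cmul[OF has_derivative_linear[OF dF]])
  next
    show "(\<lambda>x. F (x + t *\<^sub>R v)) integrable_on cbox (-b) b" for t
      by (rule integrable_continuous, rule continuous_on_compose2[OF cF(1)]) (auto intro!: continuous_intros)
  next
    show "continuous_on ({-1..1} \<times> cbox (-b) b) (\<lambda>(t, x). fx t x)"
      unfolding fx_def split_beta
      by (rule continuous_on_compose2[OF cF(2)]) (auto intro!: continuous_intros)
  qed auto
  moreover have "((\<lambda>t. integral (cbox (-b) b) (\<lambda>x. F (x + t *\<^sub>R v))) has_vector_derivative 0) (at 0 within {-1..1})"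
    by (rule has_vector_derivative_transform[OF _ _ has_vector_derivative_const[of "integral UNIV F"]]) (use const in auto)
  ultimately have "integral (cbox (-b) b) (fx 0) = 0"
    using vector_derivative_unique_within_closed_interval[of "-1" 1 0] by fastforce
  moreover have "integral UNIV (\<lambda>x. frechet_derivative F (at x) v) = integral (cbox (-b) b) (fx 0)"
  proof -
    have "frechet_derivative F (at x) v = 0" if "x \<notin> cbox (-b) b" for x
    proof -
      have "frechet_derivative F (at x) = frechet_derivative (\<lambda>x. 0) (at x)"
        by (rule frechet_derivative_cong_open[where S="- cbox (-b) b"]) (use that out[of _ 0] in auto)
      then show ?thesis by simp
    qed
    then show ?thesis using integral_cong_support[of UNIV "cbox (-b) b" "\<lambda>x. frechet_derivative F (at x) v"]
      by (auto simp: fx_def[abs_def])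
  qed
  ultimately show ?thesis by simp
qed

lemma integral_derivative_compact_support:
  fixes F :: "real^'n::{finite,wellorder} \<Rightarrow> complex"
  assumes S: "open S" and F: "smooth_on S F" and K: "compact K" "K \<subseteq> S" "\<And>x. x \<in> S - K \<Longrightarrow> F x = 0"
  shows "integral S (\<lambda>x. frechet_derivative F (at x) v) = 0"
proof -
  define G where "G x = (if x \<in> S then F x else 0)" for x
  have oK: "open (- K)" using K compact_imp_closed by auto
  have 1: "smooth_on S G" by (subst smooth_on_cong[OF S, of _ F]) (auto simp: G_def F)
  have 2: "smooth_on (- K) G" by (subst smooth_on_cong[OF oK, of _ "\<lambda>x. 0"]) (use K in \<open>auto simp: G_def smooth_on_const\<close>)
  have "S \<union> - K = UNIV" using K(2) by auto
  then have "smooth_on UNIV G" using smooth_on_Un[OF S oK 1 2] by simp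
  then have "integral UNIV (\<lambda>x. frechet_derivative G (at x) v) = 0"
    by (rule integral_directional_derivative_eq_0[OF _ K(1)]) (use K in \<open>auto simp: G_def\<close>)
  moreover have "frechet_derivative G (at x) v = 0" if "x \<notin> S" for x
  proof -
    have "frechet_derivative G (at x) = frechet_derivative (\<lambda>x. 0) (at x)"
      by (rule frechet_derivative_cong_open[OF oK]) (use that K in \<open>auto simp: G_def\<close>)
    then show ?thesis by simp
  qed
  moreover have "frechet_derivative G (at x) v = frechet_derivative F (at x) v" if "x \<in> S" for x
    using frechet_derivative_cong_open[OF S that, of G F] by (simp add: G_def)
  ultimately show ?thesis
    using integral_cong_support[of UNIV S "\<lambda>x. frechet_derivative G (at x) v"]
    by (metis (no_types, lifting) DiffD2 integral_cong subset_UNIV)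
qed

section \<open>Densities and their integral over the manifold\<close>

text \<open>On \<open>\<real>\<^sup>3\<close> a 3-form is determined by its value on the standard basis, and pulling back multiplies this
value by the Jacobian determinant. A continuous 3-form thus amounts to one function per chart with
the transformation law below.\<close>

definition continuous_density :: "'a chart set \<Rightarrow> ('a chart \<Rightarrow> real^3 \<Rightarrow> complex) \<Rightarrow> bool" where
  "continuous_density M D \<longleftrightarrow> (\<forall>c\<in>M. continuous_on (chart_img c) (D c)) \<and>
     (\<forall>c\<in>M. \<forall>d\<in>M. \<forall>x\<in>overlap c d. D c x = det (jacobian (transition c d) (at x)) *\<^sub>R D d (transition c d x))"

text \<open>Supports are described by subsets of the manifold, so that the same set serves in all charts.\<close>

definition vanishes_off :: "'a chart set \<Rightarrow> 'a set \<Rightarrow> ('a chart \<Rightarrow> real^3 \<Rightarrow> complex) \<Rightarrow> bool" where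
  "vanishes_off M K D \<longleftrightarrow> (\<forall>c\<in>M. \<forall>x\<in>chart_img c. param c x \<notin> K \<longrightarrow> D c x = 0)"

definition density_scale :: "('a \<Rightarrow> real) \<Rightarrow> ('a chart \<Rightarrow> real^3 \<Rightarrow> complex) \<Rightarrow> 'a chart \<Rightarrow> real^3 \<Rightarrow> complex" where
  "density_scale h D = (\<lambda>c x. complex_of_real (h (param c x)) * D c x)"

lemma density_integrable:
  fixes M :: "'a::t2_space chart set"
  assumes M: "oriented_atlas M" "compact (UNIV::'a set)" and c: "c \<in> M"
    and D: "continuous_density M D" "vanishes_off M K D" and K: "closed K" "K \<subseteq> chart_dom c"
    and T: "coord c ` K \<subseteq> T" "T \<subseteq> chart_img c"
  shows "D c absolutely_integrable_on T"
proof (rule absolutely_integrable_compact_support[OF _ T(1)])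
  have ch: "is_chart c" using M c atlas_is_chart by blast
  have "compact K" using K(1) M(2) by (metis compact_Int_closed inf_top_left)
  then show "compact (coord c ` K)"
    using compact_continuous_image chart_continuous_coord[OF ch] K continuous_on_subset by blast
  show "continuous_on (coord c ` K) (D c)"
    using D(1) c T continuous_on_subset unfolding continuous_density_def by (meson subset_trans)
  fix x assume x: "x \<in> T - coord c ` K"
  then have "x \<in> chart_img c" using T by blast
  moreover have "param c x \<notin> K"
    using x chart_coord_param[OF ch \<open>x \<in> chart_img c\<close>] by (metis DiffD2 imageI)
  ultimately show "D c x = 0" using D(2) c unfolding vanishes_off_def by blast
qed

text \<open>If a density lives in two charts, only the overlap contributes, and there the transition map is an
injective change of variables. The atlas is oriented, so the determinant in the transformation law
equals the absolute value in the change of variables formula.\<close>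

lemma integral_density_chart_change:
  fixes M :: "'a::t2_space chart set"
  assumes M: "oriented_atlas M" "compact (UNIV::'a set)" and c: "c \<in> M" and d: "d \<in> M"
    and D: "continuous_density M D" "vanishes_off M K D" and K: "closed K" "K \<subseteq> chart_dom c" "K \<subseteq> chart_dom d"
  shows "integral (chart_img c) (D c) = integral (chart_img d) (D d)"
proof -
  have ch: "is_chart c" "is_chart d" using M c d atlas_is_chart by blast+
  let ?S = "overlap c d" and ?T = "transition c d"
  have restrict: "integral (chart_img c) (D c) = integral (overlap c d) (D c)"
    if "c \<in> M" "is_chart c" "K \<subseteq> chart_dom d" for c d
    by (rule integral_cong_support) (use that D(2) in \<open>auto simp: overlap_eq vanishes_off_def\<close>)
  have oS: "open ?S" using open_overlap ch by blast
  have img: "?T ` ?S = overlap d c"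
  proof
    show "?T ` ?S \<subseteq> overlap d c" using transition_in_overlap[OF ch] by blast
    show "overlap d c \<subseteq> ?T ` ?S"
    proof
      fix y assume "y \<in> overlap d c"
      then show "y \<in> ?T ` ?S"
        using transition_in_overlap[OF ch(2,1)] transition_inverse[OF ch(2,1)] by (metis imageI)
    qed
  qed
  have "integral (chart_img d) (D d) = integral (?T ` ?S) (D d)" unfolding img by (rule restrict[OF d ch(2) K(2)])
  also have "\<dots> = integral ?S (\<lambda>x. \<bar>det (matrix (frechet_derivative ?T (at x)))\<bar> *\<^sub>R D d (?T x))"
  proof (rule integral_change_of_variables_complex)
    show "?S \<in> sets lebesgue" using oS by (simp add: lmeasurable_open sets_completionI_sets borel_open)
    show "(?T has_derivative frechet_derivative ?T (at x)) (at x within ?S)" if "x \<in> ?S" for x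
      using smooth_on_has_derivative[OF atlas_smooth[OF M(1) c d] that] has_derivative_at_withinI by blast
    show "inj_on ?T ?S" using transition_inverse[OF ch] by (metis inj_onI)
    show "D d absolutely_integrable_on ?T ` ?S"
      unfolding img
    proof (rule density_integrable[OF M d D K(1,3)])
      show "coord d ` K \<subseteq> overlap d c" using K(2,3) by (auto simp: overlap_def)
    qed (rule overlap_subset[OF ch(2)])
  qed
  also have "\<dots> = integral ?S (D c)"
  proof (rule integral_cong)
    fix x assume x: "x \<in> ?S"
    show "\<bar>det (matrix (frechet_derivative ?T (at x)))\<bar> *\<^sub>R D d (?T x) = D c x"
      using D(1) c d x atlas_det[OF M(1) c d x] unfolding continuous_density_def by (simp add: jacobian_def)
  qed
  also have "\<dots> = integral (chart_img c) (D c)" using restrict[OF c ch(1) K(3)] by simp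
  finally show ?thesis by simp
qed

lemma partition_of_unityD:
  assumes "partition_of_unity M F \<rho>"
  shows pu_finite: "finite F" and pu_in: "c \<in> F \<Longrightarrow> c \<in> M"
    and pu_smooth: "c \<in> F \<Longrightarrow> d \<in> M \<Longrightarrow> smooth_on (chart_img d) (\<lambda>x. \<rho> c (param d x))"
    and pu_support: "c \<in> F \<Longrightarrow> closure {p. \<rho> c p \<noteq> 0} \<subseteq> chart_dom c"
    and pu_sum: "(\<Sum>c\<in>F. \<rho> c p) = 1"
  using assms unfolding partition_of_unity_def o_def by auto

lemma continuous_density_scale:
  assumes M: "oriented_atlas M" and D: "continuous_density M D"
    and h: "\<And>d. d \<in> M \<Longrightarrow> continuous_on (chart_img d) (\<lambda>x. h (param d x))"
  shows "continuous_density M (density_scale h D)"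
  using D h param_transition[OF atlas_is_chart[OF M] atlas_is_chart[OF M]] unfolding continuous_density_def density_scale_def
  by (auto intro!: continuous_intros)

lemma vanishes_off_scale:
  "vanishes_off M K D \<Longrightarrow> vanishes_off M (closure {p. h p \<noteq> 0} \<inter> K) (density_scale h D)"
  using closure_subset[of "{p. h p \<noteq> 0}"] unfolding vanishes_off_def density_scale_def by auto

definition partition_integral :: "'a chart set \<Rightarrow> ('a chart \<Rightarrow> 'a \<Rightarrow> real) \<Rightarrow> ('a chart \<Rightarrow> real^3 \<Rightarrow> complex) \<Rightarrow> complex" where
  "partition_integral F \<rho> D = (\<Sum>c\<in>F. integral (chart_img c) (density_scale (\<rho> c) D c))"

context
  fixes M :: "'a::t2_space chart set" and F \<rho>
  assumes M: "oriented_atlas M" "compact (UNIV::'a set)" and pu: "partition_of_unity M F \<rho>"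
begin

lemma continuous_density_partition:
  assumes D: "continuous_density M D" and c: "c \<in> F"
  shows "continuous_density M (density_scale (\<rho> c) D)"
  using continuous_density_scale[OF M(1) D] pu_smooth[OF pu c] smooth_on_continuous by blast

lemma partition_integrable:
  assumes D: "continuous_density M D" and c: "c \<in> F"
  shows "density_scale (\<rho> c) D c integrable_on chart_img c"
proof -
  have "vanishes_off M (closure {p. \<rho> c p \<noteq> 0}) (density_scale (\<rho> c) D)"
    using vanishes_off_scale[of M UNIV D "\<rho> c"] by (simp add: vanishes_off_def)
  then have "density_scale (\<rho> c) D c absolutely_integrable_on chart_img c"
    by (rule density_integrable[OF M pu_in[OF pu c] continuous_density_partition[OF D c] _ closed_closure pu_support[OF pu c]])
      (use pu_support[OF pu c] in \<open>auto simp: chart_img_def\<close>)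
  then show ?thesis using set_lebesgue_integral_eq_integral(1) by blast
qed

lemma partition_integral_add:
  assumes "continuous_density M D" "continuous_density M E"
  shows "partition_integral F \<rho> (\<lambda>c x. D c x + E c x) = partition_integral F \<rho> D + partition_integral F \<rho> E"
proof -
  have "integral (chart_img c) (density_scale (\<rho> c) (\<lambda>c x. D c x + E c x) c) =
      integral (chart_img c) (density_scale (\<rho> c) D c) + integral (chart_img c) (density_scale (\<rho> c) E c)" if "c \<in> F" for c
    using Henstock_Kurzweil_Integration.integral_add[OF partition_integrable[OF assms(1) that] partition_integrable[OF assms(2) that]]
    by (simp add: density_scale_def algebra_simps)
  then show ?thesis by (simp add: partition_integral_def sum.distrib)
qed

lemma partition_integral_uminus:
  "partition_integral F \<rho> (\<lambda>c x. - D c x) = - partition_integral F \<rho> D"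
  by (simp add: partition_integral_def density_scale_def sum_negf)

lemma partition_integral_sum:
  assumes "finite I" "\<And>i. i \<in> I \<Longrightarrow> continuous_density M (D i)"
  shows "partition_integral F \<rho> (\<lambda>c x. \<Sum>i\<in>I. D i c x) = (\<Sum>i\<in>I. partition_integral F \<rho> (D i))"
proof -
  have "integral (chart_img c) (density_scale (\<rho> c) (\<lambda>c x. \<Sum>i\<in>I. D i c x) c) =
     (\<Sum>i\<in>I. integral (chart_img c) (density_scale (\<rho> c) (D i) c))" if "c \<in> F" for c
    using Henstock_Kurzweil_Integration.integral_sum[OF assms(1) partition_integrable[OF assms(2) that]]
    by (simp add: density_scale_def sum_distrib_left)
  then have "partition_integral F \<rho> (\<lambda>c x. \<Sum>i\<in>I. D i c x) = (\<Sum>c\<in>F. \<Sum>i\<in>I. integral (chart_img c) (density_scale (\<rho> c) (D i) c))"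
    unfolding partition_integral_def by (intro sum.cong) auto
  also have "\<dots> = (\<Sum>i\<in>I. partition_integral F \<rho> (D i))"
    unfolding partition_integral_def by (rule sum.swap)
  finally show ?thesis .
qed

lemma partition_integral_cong:
  assumes "\<And>c x. c \<in> M \<Longrightarrow> x \<in> chart_img c \<Longrightarrow> D c x = E c x"
  shows "partition_integral F \<rho> D = partition_integral F \<rho> E"
  unfolding partition_integral_def density_scale_def
  by (intro sum.cong refl Henstock_Kurzweil_Integration.integral_cong) (use assms pu_in[OF pu] in auto)

text \<open>For a density supported in the domain of \<open>d\<close>, each piece of the partition can be integrated in \<open>d\<close>
instead of in its own chart, and the pieces add up to the whole.\<close>

lemma partition_integral_single_chart:
  assumes D: "continuous_density M D" "vanishes_off M K D" and d: "d \<in> M" and K: "closed K" "K \<subseteq> chart_dom d"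
  shows "partition_integral F \<rho> D = integral (chart_img d) (D d)"
proof -
  let ?K = "\<lambda>c. closure {p. \<rho> c p \<noteq> 0} \<inter> K"
  have van: "vanishes_off M (?K c) (density_scale (\<rho> c) D)" for c by (rule vanishes_off_scale[OF D(2)])
  have clo: "closed (?K c)" for c using K(1) by auto
  have int: "density_scale (\<rho> c) D d integrable_on chart_img d" if "c \<in> F" for c
  proof -
    have "density_scale (\<rho> c) D d absolutely_integrable_on chart_img d"
      by (rule density_integrable[OF M d continuous_density_partition[OF D(1) that] van clo])
        (use K(2) in \<open>auto simp: chart_img_def\<close>)
    then show ?thesis using set_lebesgue_integral_eq_integral(1) by blast
  qed
  have "partition_integral F \<rho> D = (\<Sum>c\<in>F. integral (chart_img d) (density_scale (\<rho> c) D d))"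
    unfolding partition_integral_def
  proof (rule sum.cong[OF refl])
    fix c assume c: "c \<in> F"
    show "integral (chart_img c) (density_scale (\<rho> c) D c) = integral (chart_img d) (density_scale (\<rho> c) D d)"
      by (rule integral_density_chart_change[OF M pu_in[OF pu c] d continuous_density_partition[OF D(1) c] van clo])
        (use pu_support[OF pu c] K(2) in auto)
  qed
  also have "\<dots> = integral (chart_img d) (\<lambda>x. \<Sum>c\<in>F. density_scale (\<rho> c) D d x)"
    using Henstock_Kurzweil_Integration.integral_sum[OF pu_finite[OF pu] int] by simp
  also have "\<dots> = integral (chart_img d) (D d)"
  proof -
    have "(\<Sum>c\<in>F. density_scale (\<rho> c) D d x) = D d x" for x
      by (simp add: density_scale_def sum_distrib_right[symmetric] of_real_sum[symmetric] pu_sum[OF pu])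
    then show ?thesis by simp
  qed
  finally show ?thesis .
qed

end

text \<open>Cutting the density with the second partition gives summands that live in a single chart, whose
integral with respect to the first partition is the plain integral over that chart.\<close>

lemma partition_integral_independent:
  fixes M :: "'a::t2_space chart set"
  assumes M: "oriented_atlas M" "compact (UNIV::'a set)"
    and pu: "partition_of_unity M F \<rho>" and pu': "partition_of_unity M G \<sigma>" and D: "continuous_density M D"
  shows "partition_integral F \<rho> D = partition_integral G \<sigma> D"
proof -
  have "partition_integral F \<rho> D = partition_integral F \<rho> (\<lambda>c x. \<Sum>d\<in>G. density_scale (\<sigma> d) D c x)"
    by (simp add: density_scale_def sum_distrib_right[symmetric] of_real_sum[symmetric] pu_sum[OF pu'])
  also have "\<dots> = (\<Sum>d\<in>G. partition_integral F \<rho> (density_scale (\<sigma> d) D))"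
    by (rule partition_integral_sum[OF M pu pu_finite[OF pu']]) (rule continuous_density_partition[OF M pu' D])
  also have "\<dots> = partition_integral G \<sigma> D"
    unfolding partition_integral_def[of G]
  proof (rule sum.cong[OF refl])
    fix d assume d: "d \<in> G"
    have "vanishes_off M (closure {p. \<sigma> d p \<noteq> 0}) (density_scale (\<sigma> d) D)"
      using vanishes_off_scale[of M UNIV D "\<sigma> d"] by (simp add: vanishes_off_def)
    then show "partition_integral F \<rho> (density_scale (\<sigma> d) D) = integral (chart_img d) (density_scale (\<sigma> d) D d)"
      by (rule partition_integral_single_chart[OF M pu continuous_density_partition[OF M pu' D d] _ pu_in[OF pu' d] closed_closure pu_support[OF pu' d]])
  qed
  finally show ?thesis .
qed

definition density_of :: "('a, complex) form3 \<Rightarrow> 'a chart \<Rightarrow> real^3 \<Rightarrow> complex" where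
  "density_of \<eta> = (\<lambda>c x. \<eta> c x (axis 1 1) (axis 2 1) (axis 3 1))"

text \<open>The definite description in the definition of the integral has a unique solution, so any partition
of unity may be used to compute it.\<close>

lemma form_integral_eq_partition_integral:
  fixes M :: "'a::t2_space chart set"
  assumes M: "oriented_atlas M" "compact (UNIV::'a set)"
    and pu: "partition_of_unity M F \<rho>" and D: "continuous_density M (density_of \<eta>)"
  shows "form_integral M \<eta> = partition_integral F \<rho> (density_of \<eta>)"
proof -
  have e: "(\<Sum>c\<in>F. chart_integral c (\<rho> c) \<eta>) = partition_integral F \<rho> (density_of \<eta>)" for F \<rho>
    by (simp add: chart_integral_def partition_integral_def density_scale_def density_of_def)
  show ?thesis unfolding form_integral_def e
    by (rule the_equality) (use pu partition_integral_independent[OF M _ pu D] in blast)+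
qed

section \<open>Derivatives of sums and products\<close>

lemma smooth_1formD:
  assumes "smooth_1form M \<omega>"
  shows form_linear: "c \<in> M \<Longrightarrow> x \<in> chart_img c \<Longrightarrow> linear (\<omega> c x)"
    and form_smooth: "c \<in> M \<Longrightarrow> smooth_on (chart_img c) (\<lambda>x. \<omega> c x v)"
    and form_transform: "c \<in> M \<Longrightarrow> d \<in> M \<Longrightarrow> x \<in> overlap c d \<Longrightarrow>
      \<omega> c x v = \<omega> d (transition c d x) (frechet_derivative (transition c d) (at x) v)"
  using assms unfolding smooth_1form_def by auto

lemma frechet_derivative_add:
  "f differentiable (at x) \<Longrightarrow> g differentiable (at x) \<Longrightarrow>
   frechet_derivative (\<lambda>y. f y + g y) (at x) = (\<lambda>v. frechet_derivative f (at x) v + frechet_derivative g (at x) v)"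
  by (rule sym, rule frechet_derivative_at, rule has_derivative_add; simp add: frechet_derivative_works[symmetric])

lemma frechet_derivative_diff:
  "f differentiable (at x) \<Longrightarrow> g differentiable (at x) \<Longrightarrow>
   frechet_derivative (\<lambda>y. f y - g y) (at x) = (\<lambda>v. frechet_derivative f (at x) v - frechet_derivative g (at x) v)"
  by (rule sym, rule frechet_derivative_at, rule has_derivative_diff; simp add: frechet_derivative_works[symmetric])

lemma frechet_derivative_mult:
  fixes f g :: "'a::real_normed_vector \<Rightarrow> 'b::real_normed_algebra"
  shows "f differentiable (at x) \<Longrightarrow> g differentiable (at x) \<Longrightarrow>
   frechet_derivative (\<lambda>y. f y * g y) (at x) = (\<lambda>v. f x * frechet_derivative g (at x) v + frechet_derivative f (at x) v * g x)"
  by (rule sym, rule frechet_derivative_at, rule has_derivative_mult; simp add: frechet_derivative_works[symmetric])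

lemma frechet_derivative_sum:
  "(\<And>i. i \<in> I \<Longrightarrow> f i differentiable (at x)) \<Longrightarrow>
   frechet_derivative (\<lambda>y. \<Sum>i\<in>I. f i y) (at x) = (\<lambda>v. \<Sum>i\<in>I. frechet_derivative (f i) (at x) v)"
  by (rule sym, rule frechet_derivative_at, rule has_derivative_sum; simp add: frechet_derivative_works[symmetric])

lemma frechet_derivative_linear: "f differentiable (at x) \<Longrightarrow> linear (frechet_derivative f (at x))"
  using frechet_derivative_works has_derivative_linear by blast

section \<open>Alternating forms on \<open>\<real>\<^sup>3\<close>\<close>

lemma linear_axis_expand:
  fixes f :: "real^'n \<Rightarrow> 'b::real_normed_vector"
  assumes "linear f"
  shows "f v = (\<Sum>i\<in>UNIV. v $ i *\<^sub>R f (axis i 1))"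
proof -
  have "v = (\<Sum>i\<in>UNIV. v $ i *\<^sub>R axis i 1)"
    using basis_expansion[of v] by (simp add: scalar_mult_eq_scaleR)
  then have "f v = f (\<Sum>i\<in>UNIV. v $ i *\<^sub>R axis i 1)" by simp
  then show ?thesis by (simp add: linear_sum[OF assms] linear_cmul[OF assms])
qed

lemma alternating_expand:
  fixes g :: "real^3 \<Rightarrow> real^3 \<Rightarrow> complex"
  assumes l1: "\<And>v. linear (\<lambda>u. g u v)" and l2: "\<And>u. linear (g u)" and alt: "\<And>u v. g u v = - g v u"
  shows "g u v = of_real (u$1 * v$2 - u$2 * v$1) * g (axis 1 1) (axis 2 1)
       + of_real (u$1 * v$3 - u$3 * v$1) * g (axis 1 1) (axis 3 1)
       + of_real (u$2 * v$3 - u$3 * v$2) * g (axis 2 1) (axis 3 1)"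
proof -
  have z: "g w w = 0" for w using alt[of w w] by simp
  have s: "g (axis 2 1) (axis 1 1) = - g (axis 1 1) (axis 2 1)"
       "g (axis 3 1) (axis 1 1) = - g (axis 1 1) (axis 3 1)"
       "g (axis 3 1) (axis 2 1) = - g (axis 2 1) (axis 3 1)" by (rule alt)+
  have "g u v = (\<Sum>i\<in>UNIV. u $ i *\<^sub>R g (axis i 1) v)" by (rule linear_axis_expand[OF l1])
  also have "\<dots> = (\<Sum>i\<in>UNIV. u $ i *\<^sub>R (\<Sum>j\<in>UNIV. v $ j *\<^sub>R g (axis i 1) (axis j 1)))"
    using linear_axis_expand[OF l2] by metis
  finally show ?thesis
    by (simp add: sum_3 z s scaleR_conv_of_real algebra_simps)
qed

text \<open>The wedge of a linear form and an alternating bilinear form is an alternating trilinear form on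
\<open>\<real>\<^sup>3\<close>, hence a multiple of the determinant.\<close>

lemma alternating_det:
  fixes b :: "real^3 \<Rightarrow> complex" and g :: "real^3 \<Rightarrow> real^3 \<Rightarrow> complex" and L :: "real^3 \<Rightarrow> real^3"
  assumes b: "linear b" and l1: "\<And>v. linear (\<lambda>u. g u v)" and l2: "\<And>u. linear (g u)" and alt: "\<And>u v. g u v = - g v u"
  defines "W \<equiv> \<lambda>u v w. b u * g v w - b v * g u w + b w * g u v"
  shows "W (L (axis 1 1)) (L (axis 2 1)) (L (axis 3 1)) = det (matrix L) *\<^sub>R W (axis 1 1) (axis 2 1) (axis 3 1)"
proof -
  have be: "b u = of_real (u$1) * b (axis 1 1) + of_real (u$2) * b (axis 2 1) + of_real (u$3) * b (axis 3 1)" for u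
    using linear_axis_expand[OF b, of u] by (simp add: sum_3 scaleR_conv_of_real)
  have m: "matrix L $ i $ j = L (axis j 1) $ i" for i j by (simp add: matrix_def)
  define b1 b2 b3 where "b1 = b (axis 1 1)" and "b2 = b (axis 2 1)" and "b3 = b (axis 3 1)"
  define g12 g13 g23 where "g12 = g (axis 1 1) (axis 2 1)" and "g13 = g (axis 1 1) (axis 3 1)" and "g23 = g (axis 2 1) (axis 3 1)"
  note be' = be[folded b1_def b2_def b3_def]
  note ge' = alternating_expand[OF l1 l2 alt, folded g12_def g13_def g23_def]
  show ?thesis unfolding W_def
    unfolding b1_def[symmetric] b2_def[symmetric] b3_def[symmetric] g12_def[symmetric] g13_def[symmetric] g23_def[symmetric]
    unfolding be'[of "L u" for u] ge'[of "L u" "L v" for u v] det_3 m scaleR_conv_of_real of_real_add of_real_diff of_real_mult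
    by algebra
qed

section \<open>The exterior derivative of a 1-form\<close>

context
  fixes M :: "'a::t2_space chart set" and c :: "'a chart" and x :: "real^3"
  assumes M: "oriented_atlas M" and c: "c \<in> M" and x: "x \<in> chart_img c"
begin

lemma open_img: "open (chart_img c)" using chart_open_img atlas_is_chart[OF M c] by blast

lemma form_differentiable: "smooth_1form M \<gamma> \<Longrightarrow> (\<lambda>y. \<gamma> c y v) differentiable (at x)"
  using smooth_on_differentiable[OF form_smooth[OF _ c] x] .

lemma form_derivative_linear1:
  "smooth_1form M \<gamma> \<Longrightarrow> linear (\<lambda>u. frechet_derivative (\<lambda>y. \<gamma> c y v) (at x) u)"
  using frechet_derivative_linear[OF form_differentiable] .

text \<open>Linearity of the form holds only at points of the chart image; as this set is open, it passes to the
derivative.\<close>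

lemma form_derivative_linear2:
  fixes \<gamma> :: "('a, 'b::real_normed_vector) form1"
  assumes g: "smooth_1form M \<gamma>"
  shows "linear (\<lambda>v. frechet_derivative (\<lambda>y. \<gamma> c y v) (at x) u)"
proof (rule linearI)
  fix v w
  have "frechet_derivative (\<lambda>y. \<gamma> c y (v + w)) (at x) = frechet_derivative (\<lambda>y. \<gamma> c y v + \<gamma> c y w) (at x)"
    by (rule frechet_derivative_cong_open[OF open_img x]) (use form_linear[OF g c] linear_add in blast)
  then show "frechet_derivative (\<lambda>y. \<gamma> c y (v + w)) (at x) u
     = frechet_derivative (\<lambda>y. \<gamma> c y v) (at x) u + frechet_derivative (\<lambda>y. \<gamma> c y w) (at x) u"
    by (simp add: frechet_derivative_add form_differentiable[OF g])
next
  fix r v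
  have "frechet_derivative (\<lambda>y. \<gamma> c y (r *\<^sub>R v)) (at x) = frechet_derivative (\<lambda>y. r *\<^sub>R \<gamma> c y v) (at x)"
    by (rule frechet_derivative_cong_open[OF open_img x]) (use form_linear[OF g c] linear_cmul in blast)
  then show "frechet_derivative (\<lambda>y. \<gamma> c y (r *\<^sub>R v)) (at x) u = r *\<^sub>R frechet_derivative (\<lambda>y. \<gamma> c y v) (at x) u"
    by (simp add: frechet_derivative_bounded_linear[OF bounded_linear_scaleR_right form_differentiable[OF g]])
qed

lemma ext_deriv_linear1: "smooth_1form M \<gamma> \<Longrightarrow> linear (\<lambda>u. ext_deriv \<gamma> c x u v)"
  unfolding ext_deriv_def using linear_compose_sub[OF form_derivative_linear1 form_derivative_linear2] .

lemma ext_deriv_linear2: "smooth_1form M \<gamma> \<Longrightarrow> linear (ext_deriv \<gamma> c x u)"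
  unfolding ext_deriv_def using linear_compose_sub[OF form_derivative_linear2 form_derivative_linear1] .

text \<open>Naturality of the exterior derivative. Differentiating the transformation law of \<open>\<gamma>\<close> produces an
extra term with the second derivative of the transition map, which is symmetric and cancels upon
antisymmetrisation.\<close>

lemma ext_deriv_transform:
  fixes \<gamma> :: "('a, 'b::real_normed_vector) form1"
  assumes g: "smooth_1form M \<gamma>" and d: "d \<in> M" and xo: "x \<in> overlap c d"
  defines "T \<equiv> transition c d"
  shows "ext_deriv \<gamma> c x u v = ext_deriv \<gamma> d (T x) (frechet_derivative T (at x) u) (frechet_derivative T (at x) v)"
proof -
  have ch: "is_chart c" "is_chart d" using M c d atlas_is_chart by blast+
  have oS: "open (overlap c d)" using open_overlap ch by blast
  have T: "smooth_on (overlap c d) T" unfolding T_def using atlas_smooth[OF M c d] .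
  have Tin: "T y \<in> chart_img d" if "y \<in> overlap c d" for y
    using transition_in_overlap[OF ch that] overlap_subset[OF ch(2)] unfolding T_def by blast
  define T' where "T' y = frechet_derivative T (at y)" for y
  define T'' where "T'' v = frechet_derivative (\<lambda>y. T' y v) (at x)" for v
  define g' where "g' i = frechet_derivative (\<lambda>z. \<gamma> d z (axis i 1)) (at (T x))" for i
  have e: "\<gamma> c y v = (\<Sum>i\<in>UNIV. T' y v $ i *\<^sub>R \<gamma> d (T y) (axis i 1))" if "y \<in> overlap c d" for y v
    using trans[OF form_transform[OF g c d that, folded T_def] linear_axis_expand[OF form_linear[OF g d Tin[OF that]]]]
    unfolding T'_def .
  have pd: "frechet_derivative (\<lambda>y. \<gamma> c y v) (at x) u = (\<Sum>i\<in>UNIV. T' x v $ i *\<^sub>R g' i (T' x u) + T'' v u $ i *\<^sub>R \<gamma> d (T x) (axis i 1))" for u v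
  proof -
    have hT: "(T has_derivative T' x) (at x)" unfolding T'_def using smooth_on_has_derivative[OF T xo] .
    have hT': "((\<lambda>y. T' y v) has_derivative T'' v) (at x)" unfolding T''_def T'_def
      using smooth_on_has_derivative[OF smooth_on_derivative[OF T] xo] .
    have hg: "((\<lambda>z. \<gamma> d z (axis i 1)) has_derivative g' i) (at (T x))" for i
      unfolding g'_def using smooth_on_has_derivative[OF form_smooth[OF g d] Tin[OF xo]] .
    have "((\<lambda>y. \<Sum>i\<in>UNIV. T' y v $ i *\<^sub>R \<gamma> d (T y) (axis i 1)) has_derivative
       (\<lambda>u. \<Sum>i\<in>UNIV. T' x v $ i *\<^sub>R g' i (T' x u) + T'' v u $ i *\<^sub>R \<gamma> d (T x) (axis i 1))) (at x)"
      by (intro has_derivative_sum has_derivative_scaleR has_derivative_compose[OF hT hg]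
          bounded_linear.has_derivative[OF bounded_linear_vec_nth hT'])
    note hD = this
    have "frechet_derivative (\<lambda>y. \<Sum>i\<in>UNIV. T' y v $ i *\<^sub>R \<gamma> d (T y) (axis i 1)) (at x) u
       = (\<Sum>i\<in>UNIV. T' x v $ i *\<^sub>R g' i (T' x u) + T'' v u $ i *\<^sub>R \<gamma> d (T x) (axis i 1))"
      by (rule fun_cong[OF frechet_derivative_at[OF hD], symmetric])
    moreover have "frechet_derivative (\<lambda>y. \<gamma> c y v) (at x) = frechet_derivative (\<lambda>y. \<Sum>i\<in>UNIV. T' y v $ i *\<^sub>R \<gamma> d (T y) (axis i 1)) (at x)"
      by (rule frechet_derivative_cong_open[OF oS xo e])
    ultimately show ?thesis by simp
  qed
  have pd': "frechet_derivative (\<lambda>z. \<gamma> d z w) (at (T x)) u' = (\<Sum>i\<in>UNIV. w $ i *\<^sub>R g' i u')" for w u'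
  proof -
    have hg: "((\<lambda>z. \<gamma> d z (axis i 1)) has_derivative g' i) (at (T x))" for i
      unfolding g'_def using smooth_on_has_derivative[OF form_smooth[OF g d] Tin[OF xo]] .
    have "((\<lambda>z. \<Sum>i\<in>UNIV. w $ i *\<^sub>R \<gamma> d z (axis i 1)) has_derivative (\<lambda>u'. \<Sum>i\<in>UNIV. w $ i *\<^sub>R g' i u')) (at (T x))"
      by (intro has_derivative_sum has_derivative_scaleR_right hg)
    note hD = this
    have "frechet_derivative (\<lambda>z. \<Sum>i\<in>UNIV. w $ i *\<^sub>R \<gamma> d z (axis i 1)) (at (T x)) u' = (\<Sum>i\<in>UNIV. w $ i *\<^sub>R g' i u')"
      by (rule fun_cong[OF frechet_derivative_at[OF hD], symmetric])
    moreover have "frechet_derivative (\<lambda>z. \<gamma> d z w) (at (T x)) = frechet_derivative (\<lambda>z. \<Sum>i\<in>UNIV. w $ i *\<^sub>R \<gamma> d z (axis i 1)) (at (T x))"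
      by (rule frechet_derivative_cong_open[OF chart_open_img[OF ch(2)] Tin[OF xo]])
        (rule linear_axis_expand[OF form_linear[OF g d]])
    ultimately show ?thesis by simp
  qed
  have "T'' v u = T'' u v" unfolding T''_def T'_def
    using second_derivative_symmetric[OF oS xo T] .
  then show ?thesis unfolding ext_deriv_def pd pd' T'_def[symmetric] by (simp add: sum.distrib)
qed

lemma ext_deriv_add:
  assumes "smooth_1form M \<beta>" "smooth_1form M \<gamma>"
  shows "ext_deriv (\<lambda>c x v. \<beta> c x v + \<gamma> c x v) c x u v = ext_deriv \<beta> c x u v + ext_deriv \<gamma> c x u v"
  unfolding ext_deriv_def by (simp add: frechet_derivative_add form_differentiable assms)

lemma ext_deriv_sum:
  assumes "\<And>i. i \<in> I \<Longrightarrow> smooth_1form M (\<beta> i)"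
  shows "ext_deriv (\<lambda>c x v. \<Sum>i\<in>I. \<beta> i c x v) c x u v = (\<Sum>i\<in>I. ext_deriv (\<beta> i) c x u v)"
  unfolding ext_deriv_def by (simp add: frechet_derivative_sum form_differentiable assms sum_subtractf)

end

lemma continuous_density_wedge:
  fixes M :: "'a::t2_space chart set"
  assumes M: "oriented_atlas M" and b: "smooth_1form M \<beta>" and g: "smooth_1form M \<gamma>"
  shows "continuous_density M (density_of (wedge12 \<beta> (ext_deriv \<gamma>)))"
  unfolding continuous_density_def
proof (intro conjI ballI)
  fix c assume c: "c \<in> M"
  have "open (chart_img c)" using chart_open_img atlas_is_chart[OF M c] by blast
  then have "smooth_on (chart_img c) (density_of (wedge12 \<beta> (ext_deriv \<gamma>)) c)"
    unfolding density_of_def wedge12_def ext_deriv_def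
    by (intro smooth_on_add smooth_on_diff smooth_on_mult smooth_on_derivative form_smooth[OF b c] form_smooth[OF g c])
  then show "continuous_on (chart_img c) (density_of (wedge12 \<beta> (ext_deriv \<gamma>)) c)" by (rule smooth_on_continuous)
next
  fix c d x assume c: "c \<in> M" and d: "d \<in> M" and x: "x \<in> overlap c d"
  have ch: "is_chart c" "is_chart d" using M c d atlas_is_chart by blast+
  have xc: "x \<in> chart_img c" using x overlap_subset[OF ch(1)] by blast
  have Tx: "transition c d x \<in> chart_img d" using transition_in_overlap[OF ch x] overlap_subset[OF ch(2)] by blast
  have alt: "ext_deriv \<gamma> d y u v = - ext_deriv \<gamma> d y v u" for y u v by (simp add: ext_deriv_def)
  show "density_of (wedge12 \<beta> (ext_deriv \<gamma>)) c x =
        det (jacobian (transition c d) (at x)) *\<^sub>R density_of (wedge12 \<beta> (ext_deriv \<gamma>)) d (transition c d x)"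
    using alternating_det[OF form_linear[OF b d Tx] ext_deriv_linear1[OF M d Tx g] ext_deriv_linear2[OF M d Tx g] alt, of "frechet_derivative (transition c d) (at x)"]
    by (simp add: density_of_def wedge12_def jacobian_def ext_deriv_transform[OF M c xc g d x] form_transform[OF b c d x])
qed

section \<open>Smooth functions on the manifold\<close>

definition smooth_0form :: "'a chart set \<Rightarrow> ('a chart \<Rightarrow> real^3 \<Rightarrow> 'b::real_normed_vector) \<Rightarrow> bool" where
  "smooth_0form M f \<longleftrightarrow> (\<forall>c\<in>M. smooth_on (chart_img c) (f c)) \<and>
     (\<forall>c\<in>M. \<forall>d\<in>M. \<forall>x\<in>overlap c d. f c x = f d (transition c d x))"

lemma smooth_1form_scale:
  fixes \<beta> :: "('a::t2_space, complex) form1"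
  assumes M: "oriented_atlas M" and f: "smooth_0form M f" and b: "smooth_1form M \<beta>"
  shows "smooth_1form M (\<lambda>c x v. f c x * \<beta> c x v)"
  unfolding smooth_1form_def
proof (intro conjI ballI allI)
  fix c assume c: "c \<in> M"
  have o: "open (chart_img c)" using chart_open_img atlas_is_chart[OF M c] by blast
  show "linear (\<lambda>v. f c x * \<beta> c x v)" if "x \<in> chart_img c" for x
    using linear_compose[OF form_linear[OF b c that] linear_times] by (simp add: o_def)
  show "smooth_on (chart_img c) (\<lambda>x. f c x * \<beta> c x v)" for v
    using f c by (intro smooth_on_mult o form_smooth[OF b c]) (auto simp: smooth_0form_def)
next
  fix c d x v assume "c \<in> M" "d \<in> M" "x \<in> overlap c d"
  then show "f c x * \<beta> c x v = f d (transition c d x) * \<beta> d (transition c d x) (frechet_derivative (transition c d) (at x) v)"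
    using f form_transform[OF b] unfolding smooth_0form_def by metis
qed

lemma smooth_1form_add:
  assumes M: "oriented_atlas M" and a: "smooth_1form M \<alpha>" and b: "smooth_1form M \<beta>"
  shows "smooth_1form M (\<lambda>c x v. \<alpha> c x v + \<beta> c x v)"
  unfolding smooth_1form_def
proof (intro conjI ballI allI)
  fix c assume c: "c \<in> M"
  have o: "open (chart_img c)" using chart_open_img atlas_is_chart[OF M c] by blast
  show "linear (\<lambda>v. \<alpha> c x v + \<beta> c x v)" if "x \<in> chart_img c" for x
    using linear_compose_add[OF form_linear[OF a c that] form_linear[OF b c that]] .
  show "smooth_on (chart_img c) (\<lambda>x. \<alpha> c x v + \<beta> c x v)" for v
    by (intro smooth_on_add o form_smooth[OF b c] form_smooth[OF a c])
next
  fix c d x v assume "c \<in> M" "d \<in> M" "x \<in> overlap c d"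
  then show "\<alpha> c x v + \<beta> c x v = \<alpha> d (transition c d x) (frechet_derivative (transition c d) (at x) v)
     + \<beta> d (transition c d x) (frechet_derivative (transition c d) (at x) v)"
    using form_transform[OF a] form_transform[OF b] by metis
qed

lemma smooth_1form_bounded_linear:
  assumes M: "oriented_atlas M" and h: "bounded_linear h" and a: "smooth_1form M \<alpha>"
  shows "smooth_1form M (\<lambda>c x v. h (\<alpha> c x v))"
  unfolding smooth_1form_def
proof (intro conjI ballI allI)
  fix c assume c: "c \<in> M"
  have o: "open (chart_img c)" using chart_open_img atlas_is_chart[OF M c] by blast
  show "linear (\<lambda>v. h (\<alpha> c x v))" if "x \<in> chart_img c" for x
    using linear_compose[OF form_linear[OF a c that] bounded_linear.linear[OF h]] by (simp add: o_def)
  show "smooth_on (chart_img c) (\<lambda>x. h (\<alpha> c x v))" for v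
    by (intro smooth_on_bounded_linear[OF o h] form_smooth[OF a c])
next
  fix c d x v assume "c \<in> M" "d \<in> M" "x \<in> overlap c d"
  then show "h (\<alpha> c x v) = h (\<alpha> d (transition c d x) (frechet_derivative (transition c d) (at x) v))"
    using form_transform[OF a] by metis
qed

lemma ext_deriv_bounded_linear:
  fixes \<alpha> :: "('a::t2_space, 'b::real_normed_vector) form1" and h :: "'b \<Rightarrow> 'c::real_normed_vector"
  assumes M: "oriented_atlas M" and c: "c \<in> M" and x: "x \<in> chart_img c"
    and h: "bounded_linear h" and a: "smooth_1form M \<alpha>"
  shows "ext_deriv (\<lambda>c x v. h (\<alpha> c x v)) c x u v = h (ext_deriv \<alpha> c x u v)"
  unfolding ext_deriv_def
  by (simp add: frechet_derivative_bounded_linear[OF h form_differentiable[OF M c x a]]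
      linear_diff[OF bounded_linear.linear[OF h]])

lemmas bounded_linear_uminus = bounded_linear_minus[OF bounded_linear_ident]

lemma smooth_1form_zero: "smooth_1form M (\<lambda>c x v. 0)"
  unfolding smooth_1form_def by (auto simp: smooth_on_const linear_zero module_hom_zero)

lemma smooth_0formD:
  assumes "smooth_0form M f"
  shows zero_form_smooth: "c \<in> M \<Longrightarrow> smooth_on (chart_img c) (f c)"
    and zero_form_transform: "c \<in> M \<Longrightarrow> d \<in> M \<Longrightarrow> x \<in> overlap c d \<Longrightarrow> f c x = f d (transition c d x)"
  using assms unfolding smooth_0form_def by auto

definition differential :: "('a chart \<Rightarrow> real^3 \<Rightarrow> 'b::real_normed_vector) \<Rightarrow> ('a, 'b) form1" where
  "differential f = (\<lambda>c x v. frechet_derivative (f c) (at x) v)"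

lemma smooth_1form_differential:
  assumes M: "oriented_atlas M" and f: "smooth_0form M f"
  shows "smooth_1form M (differential f)"
  unfolding smooth_1form_def
proof (intro conjI ballI allI)
  fix c assume c: "c \<in> M"
  show "linear (differential f c x)" if "x \<in> chart_img c" for x
    unfolding differential_def
    using frechet_derivative_linear[OF smooth_on_differentiable[OF zero_form_smooth[OF f c] that]] by simp
  show "smooth_on (chart_img c) (\<lambda>x. differential f c x v)" for v
    unfolding differential_def by (rule smooth_on_derivative[OF zero_form_smooth[OF f c]])
next
  fix c d x v assume c: "c \<in> M" and d: "d \<in> M" and x: "x \<in> overlap c d"
  have ch: "is_chart c" "is_chart d" using M c d atlas_is_chart by blast+
  have Tx: "transition c d x \<in> chart_img d" using transition_in_overlap[OF ch x] overlap_subset[OF ch(2)] by blast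
  have "((\<lambda>y. f d (transition c d y)) has_derivative
     (\<lambda>v. frechet_derivative (f d) (at (transition c d x)) (frechet_derivative (transition c d) (at x) v))) (at x)"
    by (rule has_derivative_compose[OF smooth_on_has_derivative[OF atlas_smooth[OF M c d] x]
        smooth_on_has_derivative[OF zero_form_smooth[OF f d] Tx]])
  from frechet_derivative_at[OF this]
  have "frechet_derivative (\<lambda>y. f d (transition c d y)) (at x)
     = (\<lambda>v. frechet_derivative (f d) (at (transition c d x)) (frechet_derivative (transition c d) (at x) v))" by (rule sym)
  moreover have "frechet_derivative (f c) (at x) = frechet_derivative (\<lambda>y. f d (transition c d y)) (at x)"
    by (rule frechet_derivative_cong_open[OF open_overlap[OF ch] x zero_form_transform[OF f c d]])
  ultimately show "differential f c x v = differential f d (transition c d x) (frechet_derivative (transition c d) (at x) v)"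
    by (simp add: differential_def)
qed

lemma smooth_0form_divide:
  fixes f g :: "'a::t2_space chart \<Rightarrow> real^3 \<Rightarrow> complex"
  assumes M: "oriented_atlas M" and f: "smooth_0form M f" and g: "smooth_0form M g"
    and nz: "\<And>c x. c \<in> M \<Longrightarrow> x \<in> chart_img c \<Longrightarrow> g c x \<noteq> 0"
  shows "smooth_0form M (\<lambda>c x. f c x / g c x)"
  unfolding smooth_0form_def
proof (intro conjI ballI)
  fix c assume c: "c \<in> M"
  have o: "open (chart_img c)" using chart_open_img atlas_is_chart[OF M c] by blast
  show "smooth_on (chart_img c) (\<lambda>x. f c x / g c x)"
    by (rule smooth_on_divide[OF o zero_form_smooth[OF f c] zero_form_smooth[OF g c] nz[OF c]])
next
  fix c d x assume "c \<in> M" "d \<in> M" "x \<in> overlap c d"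
  then show "f c x / g c x = f d (transition c d x) / g d (transition c d x)"
    using zero_form_transform[OF f] zero_form_transform[OF g] by metis
qed

lemma smooth_0form_cmult:
  fixes f :: "'a::t2_space chart \<Rightarrow> real^3 \<Rightarrow> complex"
  assumes M: "oriented_atlas M" and f: "smooth_0form M f"
  shows "smooth_0form M (\<lambda>c x. k * f c x)"
  unfolding smooth_0form_def
proof (intro conjI ballI)
  fix c assume c: "c \<in> M"
  have o: "open (chart_img c)" using chart_open_img atlas_is_chart[OF M c] by blast
  show "smooth_on (chart_img c) (\<lambda>x. k * f c x)"
    by (intro smooth_on_mult o smooth_on_const zero_form_smooth[OF f c])
next
  fix c d x assume "c \<in> M" "d \<in> M" "x \<in> overlap c d"
  then show "k * f c x = k * f d (transition c d x)"
    using zero_form_transform[OF f] by metis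
qed

lemma smooth_0form_const: "smooth_0form M (\<lambda>c x. k)"
  by (simp add: smooth_0form_def smooth_on_const)

lemma ext_deriv_scale:
  fixes \<beta> :: "('a::t2_space, complex) form1"
  assumes M: "oriented_atlas M" and c: "c \<in> M" and x: "x \<in> chart_img c"
    and f: "smooth_0form M f" and b: "smooth_1form M \<beta>"
  shows "ext_deriv (\<lambda>c x v. f c x * \<beta> c x v) c x u v = wedge11 (differential f) \<beta> c x u v + f c x * ext_deriv \<beta> c x u v"
  unfolding ext_deriv_def wedge11_def differential_def
  using smooth_on_differentiable[OF zero_form_smooth[OF f c] x] form_differentiable[OF M c x b]
  by (simp add: frechet_derivative_mult algebra_simps)

lemma ext_deriv_differential:
  fixes f :: "'a::t2_space chart \<Rightarrow> real^3 \<Rightarrow> complex"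
  assumes M: "oriented_atlas M" and c: "c \<in> M" and x: "x \<in> chart_img c" and f: "smooth_0form M f"
  shows "ext_deriv (differential f) c x u v = 0"
proof -
  have o: "open (chart_img c)" using chart_open_img atlas_is_chart[OF M c] by blast
  show ?thesis unfolding ext_deriv_def differential_def
    using second_derivative_symmetric[OF o x zero_form_smooth[OF f c], of u v] by simp
qed

definition log_differential :: "('a chart \<Rightarrow> real^3 \<Rightarrow> complex) \<Rightarrow> ('a, complex) form1" where
  "log_differential p = (\<lambda>c x v. (1 / p c x) * differential p c x v)"

lemma
  fixes p :: "'a::t2_space chart \<Rightarrow> real^3 \<Rightarrow> complex"
  assumes M: "oriented_atlas M" and p: "smooth_0form M p"
    and nz: "\<And>c x. c \<in> M \<Longrightarrow> x \<in> chart_img c \<Longrightarrow> p c x \<noteq> 0"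
  shows smooth_1form_log_differential: "smooth_1form M (log_differential p)"
    and ext_deriv_log_differential: "c \<in> M \<Longrightarrow> x \<in> chart_img c \<Longrightarrow> ext_deriv (log_differential p) c x u v = 0"
proof -
  have i: "smooth_0form M (\<lambda>c x. 1 / p c x)" by (rule smooth_0form_divide[OF M smooth_0form_const p nz])
  show "smooth_1form M (log_differential p)"
    unfolding log_differential_def by (rule smooth_1form_scale[OF M i smooth_1form_differential[OF M p]])
  assume c: "c \<in> M" and x: "x \<in> chart_img c"
  have "((\<lambda>y. inverse (p c y)) has_derivative (\<lambda>v. - (inverse (p c x) * frechet_derivative (p c) (at x) v * inverse (p c x)))) (at x)"
    by (rule Deriv.has_derivative_inverse[OF nz[OF c x] smooth_on_has_derivative[OF zero_form_smooth[OF p c] x]])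
  note fun_cong[OF frechet_derivative_at[OF this], symmetric]
  then have di: "differential (\<lambda>c x. 1 / p c x) c x v = - (inverse (p c x) * differential p c x v * inverse (p c x))" for v
    unfolding differential_def inverse_eq_divide[symmetric] .
  show "ext_deriv (log_differential p) c x u v = 0"
    unfolding log_differential_def ext_deriv_scale[OF M c x i smooth_1form_differential[OF M p]] wedge11_def di
    by (simp add: ext_deriv_differential[OF M c x p])
qed

section \<open>Stokes' theorem as symmetry of a pairing\<close>

lemma has_integral_derivative_compact_support:
  fixes F :: "real^'n::{finite,wellorder} \<Rightarrow> complex"
  assumes S: "open S" and F: "smooth_on S F" and K: "compact K" "K \<subseteq> S" "\<And>x. x \<in> S - K \<Longrightarrow> F x = 0"
  shows "((\<lambda>x. frechet_derivative F (at x) v) has_integral 0) S"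
proof -
  have o: "open (S - K)" using S K compact_imp_closed by blast
  have z: "frechet_derivative F (at x) v = 0" if "x \<in> S - K" for x
    using frechet_derivative_cong_open[OF o that, of F "\<lambda>x. 0"] K(3) by simp
  have "(\<lambda>x. frechet_derivative F (at x) v) absolutely_integrable_on S"
    by (rule absolutely_integrable_compact_support[OF K(1,2) _ z])
      (use smooth_on_continuous[OF smooth_on_derivative[OF F]] K(2) continuous_on_subset in blast)
  then show ?thesis
    using integral_derivative_compact_support[OF assms] set_lebesgue_integral_eq_integral(1) by (metis has_integral_integral)
qed

text \<open>The density of \<open>\<beta> \<and> d\<gamma> - \<gamma> \<and> d\<beta> = - d(\<beta> \<and> \<gamma>)\<close>, written without forms of degree 2.\<close>

definition stokes_density :: "('a, complex) form1 \<Rightarrow> ('a, complex) form1 \<Rightarrow> 'a chart \<Rightarrow> real^3 \<Rightarrow> complex" where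
  "stokes_density \<beta> \<gamma> = (\<lambda>c x. density_of (wedge12 \<beta> (ext_deriv \<gamma>)) c x + - density_of (wedge12 \<gamma> (ext_deriv \<beta>)) c x)"

text \<open>In coordinates the density is the divergence of a compactly supported vector field whose components
are those of \<open>\<gamma> \<and> \<beta>\<close>.\<close>

lemma integral_stokes_density:
  fixes M :: "'a::t2_space chart set"
  assumes M: "oriented_atlas M" and c: "c \<in> M" and b: "smooth_1form M \<beta>" and g: "smooth_1form M \<gamma>"
    and K: "compact K" "K \<subseteq> chart_img c" "\<And>x v. x \<in> chart_img c - K \<Longrightarrow> \<beta> c x v = 0"
  shows "integral (chart_img c) (stokes_density \<beta> \<gamma> c) = 0"
proof -
  have o: "open (chart_img c)" using chart_open_img atlas_is_chart[OF M c] by blast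
  define F where "F i j = (\<lambda>x. \<beta> c x (axis i 1) * \<gamma> c x (axis j 1) - \<beta> c x (axis j 1) * \<gamma> c x (axis i 1))" for i j
  have F: "smooth_on (chart_img c) (F i j)" for i j
    unfolding F_def by (intro smooth_on_diff smooth_on_mult o form_smooth[OF b c] form_smooth[OF g c])
  have 0: "((\<lambda>x. frechet_derivative (F i j) (at x) (axis k 1)) has_integral 0) (chart_img c)" for i j k
    by (rule has_integral_derivative_compact_support[OF o F K(1,2)]) (use K(3) in \<open>auto simp: F_def\<close>)
  have dF: "frechet_derivative (F i j) (at x) = (\<lambda>u.
     \<beta> c x (axis i 1) * frechet_derivative (\<lambda>y. \<gamma> c y (axis j 1)) (at x) u + frechet_derivative (\<lambda>y. \<beta> c y (axis i 1)) (at x) u * \<gamma> c x (axis j 1)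
   - (\<beta> c x (axis j 1) * frechet_derivative (\<lambda>y. \<gamma> c y (axis i 1)) (at x) u + frechet_derivative (\<lambda>y. \<beta> c y (axis j 1)) (at x) u * \<gamma> c x (axis i 1)))"
    if "x \<in> chart_img c" for x i j
    unfolding F_def using form_differentiable[OF M c that b] form_differentiable[OF M c that g]
    by (simp add: frechet_derivative_diff frechet_derivative_mult)
  have "((\<lambda>x. frechet_derivative (F 3 2) (at x) (axis 1 1) + frechet_derivative (F 1 3) (at x) (axis 2 1)
      + frechet_derivative (F 2 1) (at x) (axis 3 1)) has_integral 0 + 0 + 0) (chart_img c)"
    by (intro has_integral_add 0)
  moreover have "frechet_derivative (F 3 2) (at x) (axis 1 1) + frechet_derivative (F 1 3) (at x) (axis 2 1)
      + frechet_derivative (F 2 1) (at x) (axis 3 1) = stokes_density \<beta> \<gamma> c x" if "x \<in> chart_img c" for x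
    by (simp add: dF[OF that] stokes_density_def density_of_def wedge12_def ext_deriv_def algebra_simps)
  ultimately have "(stokes_density \<beta> \<gamma> c has_integral 0) (chart_img c)"
    by (metis (no_types, lifting) add_0 has_integral_cong)
  then show ?thesis by (rule integral_unique)
qed

abbreviation pairing :: "'a::t2_space chart set \<Rightarrow> ('a, complex) form1 \<Rightarrow> ('a, complex) form1 \<Rightarrow> complex" where
  "pairing M \<beta> \<gamma> \<equiv> form_integral M (wedge12 \<beta> (ext_deriv \<gamma>))"

lemma smooth_1form_partition:
  fixes \<beta> :: "('a::t2_space, complex) form1"
  assumes M: "oriented_atlas M" and pu: "partition_of_unity M F \<rho>" and d: "d \<in> F" and b: "smooth_1form M \<beta>"
  shows "smooth_1form M (\<lambda>c x v. complex_of_real (\<rho> d (param c x)) * \<beta> c x v)"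
proof (rule smooth_1form_scale[OF M _ b], unfold smooth_0form_def, intro conjI ballI)
  fix c assume c: "c \<in> M"
  have "open (chart_img c)" using chart_open_img atlas_is_chart[OF M c] by blast
  then show "smooth_on (chart_img c) (\<lambda>x. complex_of_real (\<rho> d (param c x)))"
    by (rule smooth_on_bounded_linear[OF _ bounded_linear_of_real pu_smooth[OF pu d c]])
next
  fix c e x assume "c \<in> M" "e \<in> M" "x \<in> overlap c e"
  then show "complex_of_real (\<rho> d (param c x)) = complex_of_real (\<rho> d (param e (transition c e x)))"
    using param_transition[OF atlas_is_chart[OF M] atlas_is_chart[OF M]] by metis
qed

text \<open>Stokes' theorem for \<open>d(\<beta> \<and> \<gamma>)\<close>: by linearity \<open>\<beta>\<close> may be replaced by its products with the functions
of a partition of unity, and each of these is supported in a single chart.\<close>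

lemma pairing_symmetric:
  fixes M :: "'a::t2_space chart set"
  assumes M: "oriented_atlas M" "compact (UNIV::'a set)" and b: "smooth_1form M \<beta>" and g: "smooth_1form M \<gamma>"
  shows "pairing M \<beta> \<gamma> = pairing M \<gamma> \<beta>"
proof -
  obtain F \<rho> where pu: "partition_of_unity M F \<rho>" using partition_of_unity_exists[OF M] by blast
  define \<beta>' where "\<beta>' d = (\<lambda>c x v. complex_of_real (\<rho> d (param c x)) * \<beta> c x v)" for d
  have b': "smooth_1form M (\<beta>' d)" if "d \<in> F" for d
    unfolding \<beta>'_def using smooth_1form_partition[OF M(1) pu that b] .
  have dens: "continuous_density M (\<lambda>c x. - density_of (wedge12 \<beta> (ext_deriv \<gamma>)) c x)"
    if "smooth_1form M \<beta>" "smooth_1form M \<gamma>" for \<beta> \<gamma>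
    using continuous_density_wedge[OF M(1) that] unfolding continuous_density_def by (auto intro: continuous_intros)
  have sd: "continuous_density M (stokes_density (\<beta>' d) \<gamma>)" if "d \<in> F" for d
    using continuous_density_wedge[OF M(1) b'[OF that] g] continuous_density_wedge[OF M(1) g b'[OF that]]
    unfolding continuous_density_def stokes_density_def
    by (auto intro!: continuous_intros simp: algebra_simps)
  have sum1: "\<beta> = (\<lambda>c x v. \<Sum>d\<in>F. \<beta>' d c x v)"
    by (simp add: \<beta>'_def sum_distrib_right[symmetric] of_real_sum[symmetric] pu_sum[OF pu])
  have "partition_integral F \<rho> (stokes_density \<beta> \<gamma>) = pairing M \<beta> \<gamma> + - pairing M \<gamma> \<beta>"
    unfolding stokes_density_def form_integral_eq_partition_integral[OF M pu continuous_density_wedge[OF M(1) b g]]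
      form_integral_eq_partition_integral[OF M pu continuous_density_wedge[OF M(1) g b]] partition_integral_uminus[OF M pu, symmetric]
    by (rule partition_integral_add[OF M pu continuous_density_wedge[OF M(1) b g] dens[OF g b]])
  then have "pairing M \<beta> \<gamma> - pairing M \<gamma> \<beta> = partition_integral F \<rho> (stokes_density \<beta> \<gamma>)" by simp
  also have "\<dots> = partition_integral F \<rho> (\<lambda>c x. \<Sum>d\<in>F. stokes_density (\<beta>' d) \<gamma> c x)"
  proof (rule partition_integral_cong[OF M pu])
    fix c x assume c: "c \<in> M" and x: "x \<in> chart_img c"
    have "ext_deriv \<beta> c x u v = (\<Sum>d\<in>F. ext_deriv (\<beta>' d) c x u v)" for u v
      by (subst sum1) (rule ext_deriv_sum[OF M(1) c x b'])
    moreover have "\<beta> c x v = (\<Sum>d\<in>F. \<beta>' d c x v)" for v by (subst sum1) simp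
    ultimately show "stokes_density \<beta> \<gamma> c x = (\<Sum>d\<in>F. stokes_density (\<beta>' d) \<gamma> c x)"
      by (simp add: stokes_density_def density_of_def wedge12_def sum_distrib_left sum_distrib_right sum.distrib sum_subtractf algebra_simps)
  qed
  also have "\<dots> = (\<Sum>d\<in>F. partition_integral F \<rho> (stokes_density (\<beta>' d) \<gamma>))"
    by (rule partition_integral_sum[OF M pu pu_finite[OF pu] sd])
  also have "\<dots> = (\<Sum>d\<in>F. 0)"
  proof (rule sum.cong[OF refl])
    fix d assume d: "d \<in> F"
    have dM: "d \<in> M" using pu_in[OF pu d] .
    have ch: "is_chart d" using atlas_is_chart[OF M(1) dM] .
    let ?K = "closure {p. \<rho> d p \<noteq> 0}"
    have z: "\<beta>' d c x v = 0" if "param c x \<notin> ?K" for c x v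
      using that closure_subset[of "{p. \<rho> d p \<noteq> 0}"] by (auto simp: \<beta>'_def)
    have van: "vanishes_off M ?K (stokes_density (\<beta>' d) \<gamma>)"
      unfolding vanishes_off_def
    proof (intro ballI impI)
      fix c x assume c: "c \<in> M" and x: "x \<in> chart_img c" "param c x \<notin> ?K"
      have o: "open {y \<in> chart_img c. param c y \<in> - ?K}"
        using open_chart_preimage[OF atlas_is_chart[OF M(1) c]] by blast
      have "frechet_derivative (\<lambda>y. \<beta>' d c y v) (at x) = frechet_derivative (\<lambda>y. 0) (at x)" for v
        by (rule frechet_derivative_cong_open[OF o]) (use x z in auto)
      then show "stokes_density (\<beta>' d) \<gamma> c x = 0"
        by (simp add: stokes_density_def density_of_def wedge12_def ext_deriv_def z[OF x(2)])
    qed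
    have "compact ?K" using M(2) by (metis closed_closure compact_Int_closed inf_top_left)
    then have "compact (coord d ` ?K)"
      using compact_continuous_image chart_continuous_coord[OF ch] pu_support[OF pu d] continuous_on_subset by blast
    moreover have "coord d ` ?K \<subseteq> chart_img d" using pu_support[OF pu d] by (auto simp: chart_img_def)
    moreover have "\<beta>' d d x v = 0" if "x \<in> chart_img d - coord d ` ?K" for x v
      using that chart_coord_param[OF ch, of x] by (intro z) (metis DiffD1 DiffD2 imageI)
    ultimately have "integral (chart_img d) (stokes_density (\<beta>' d) \<gamma> d) = 0"
      by (rule integral_stokes_density[OF M(1) dM b'[OF d] g])
    then show "partition_integral F \<rho> (stokes_density (\<beta>' d) \<gamma>) = 0"
      using partition_integral_single_chart[OF M pu sd[OF d] van dM closed_closure pu_support[OF pu d]] by simp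
  qed
  finally show ?thesis by simp
qed

lemma pairing_add1:
  fixes M :: "'a::t2_space chart set"
  assumes M: "oriented_atlas M" "compact (UNIV::'a set)"
    and "smooth_1form M \<alpha>" "smooth_1form M \<beta>" "smooth_1form M \<gamma>"
  shows "pairing M (\<lambda>c x v. \<alpha> c x v + \<beta> c x v) \<gamma> = pairing M \<alpha> \<gamma> + pairing M \<beta> \<gamma>"
proof -
  obtain F \<rho> where pu: "partition_of_unity M F \<rho>" using partition_of_unity_exists[OF M] by blast
  have "density_of (wedge12 (\<lambda>c x v. \<alpha> c x v + \<beta> c x v) (ext_deriv \<gamma>))
     = (\<lambda>c x. density_of (wedge12 \<alpha> (ext_deriv \<gamma>)) c x + density_of (wedge12 \<beta> (ext_deriv \<gamma>)) c x)"
    by (simp add: density_of_def wedge12_def algebra_simps)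
  then have "partition_integral F \<rho> (density_of (wedge12 (\<lambda>c x v. \<alpha> c x v + \<beta> c x v) (ext_deriv \<gamma>)))
     = partition_integral F \<rho> (density_of (wedge12 \<alpha> (ext_deriv \<gamma>))) + partition_integral F \<rho> (density_of (wedge12 \<beta> (ext_deriv \<gamma>)))"
    using partition_integral_add[OF M pu continuous_density_wedge[OF M(1) assms(3,5)] continuous_density_wedge[OF M(1) assms(4,5)]] by (simp only:)
  then show ?thesis
    unfolding form_integral_eq_partition_integral[OF M pu continuous_density_wedge[OF M(1) assms(3,5)]]
      form_integral_eq_partition_integral[OF M pu continuous_density_wedge[OF M(1) assms(4,5)]]
      form_integral_eq_partition_integral[OF M pu continuous_density_wedge[OF M(1) smooth_1form_add[OF M(1) assms(3,4)] assms(5)]] .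
qed

lemma pairing_add2:
  fixes M :: "'a::t2_space chart set"
  assumes M: "oriented_atlas M" "compact (UNIV::'a set)"
    and "smooth_1form M \<alpha>" "smooth_1form M \<beta>" "smooth_1form M \<gamma>"
  shows "pairing M \<gamma> (\<lambda>c x v. \<alpha> c x v + \<beta> c x v) = pairing M \<gamma> \<alpha> + pairing M \<gamma> \<beta>"
  using pairing_add1[OF M assms(3-5)]
  unfolding pairing_symmetric[OF M assms(5) smooth_1form_add[OF M(1) assms(3,4)]]
    pairing_symmetric[OF M assms(5,3)] pairing_symmetric[OF M assms(5,4)] .

lemma pairing_eq:
  fixes M :: "'a::t2_space chart set"
  assumes M: "oriented_atlas M" "compact (UNIV::'a set)"
    and "smooth_1form M \<alpha>" "smooth_1form M \<beta>" "smooth_1form M \<gamma>" "smooth_1form M \<delta>"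
    and "\<And>c x. c \<in> M \<Longrightarrow> x \<in> chart_img c \<Longrightarrow> density_of (wedge12 \<alpha> (ext_deriv \<beta>)) c x = density_of (wedge12 \<gamma> (ext_deriv \<delta>)) c x"
  shows "pairing M \<alpha> \<beta> = pairing M \<gamma> \<delta>"
proof -
  obtain F \<rho> where pu: "partition_of_unity M F \<rho>" using partition_of_unity_exists[OF M] by blast
  show ?thesis
    using assms partition_integral_cong[OF M pu assms(7)] by (simp add: form_integral_eq_partition_integral[OF M pu] continuous_density_wedge[OF M(1)])
qed

lemma pairing_eq_0:
  fixes M :: "'a::t2_space chart set"
  assumes M: "oriented_atlas M" "compact (UNIV::'a set)"
    and "smooth_1form M \<alpha>" "smooth_1form M \<beta>"
    and "\<And>c x. c \<in> M \<Longrightarrow> x \<in> chart_img c \<Longrightarrow> density_of (wedge12 \<alpha> (ext_deriv \<beta>)) c x = 0"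
  shows "pairing M \<alpha> \<beta> = 0"
proof -
  obtain F \<rho> where pu: "partition_of_unity M F \<rho>" using partition_of_unity_exists[OF M] by blast
  have "pairing M \<alpha> \<beta> = partition_integral F \<rho> (\<lambda>c x. 0)"
    using assms partition_integral_cong[OF M pu assms(5)] by (simp add: form_integral_eq_partition_integral[OF M pu] continuous_density_wedge[OF M(1)])
  then show ?thesis by (simp add: partition_integral_def density_scale_def)
qed

text \<open>This is \<open>d(d\<delta>) = 0\<close>: the exterior derivative of \<open>\<beta> \<and> \<gamma>\<close> is \<open>d\<beta> \<and> \<gamma> - \<beta> \<and> d\<gamma>\<close>, and it vanishes if
\<open>\<beta> \<and> \<gamma>\<close> is exact. It serves to differentiate structure equations such as \<open>d\<omega> = \<alpha> \<and> \<omega>\<close>, and, with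
\<open>\<delta> = 0\<close>, relations \<open>\<beta> \<and> \<gamma> = 0\<close>.\<close>

lemma wedge_deriv_commute:
  fixes M :: "'a::t2_space chart set" and \<beta> \<gamma> \<delta> :: "('a, complex) form1"
  assumes M: "oriented_atlas M" and b: "smooth_1form M \<beta>" and g: "smooth_1form M \<gamma>" and d: "smooth_1form M \<delta>"
    and eq: "eq_on_manifold M (ext_deriv \<delta>) (wedge11 \<beta> \<gamma>)"
    and c: "c \<in> M" and x: "x \<in> chart_img c"
  shows "density_of (wedge12 \<gamma> (ext_deriv \<beta>)) c x = density_of (wedge12 \<beta> (ext_deriv \<gamma>)) c x"
proof -
  have o: "open (chart_img c)" using chart_open_img atlas_is_chart[OF M c] by blast
  define e :: "3 \<Rightarrow> real^3" where "e i = axis i 1" for i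
  define D where "D i j k = frechet_derivative (\<lambda>y. ext_deriv \<delta> c y (e i) (e j)) (at x) (e k)" for i j k
  define H where "H i j k = frechet_derivative (\<lambda>y. frechet_derivative (\<lambda>y. \<delta> c y (e i)) (at y) (e j)) (at x) (e k)" for i j k
  define P where "P \<eta> i j = frechet_derivative (\<lambda>y. \<eta> c y (e i)) (at x) (e j)" for \<eta> :: "('a, complex) form1" and i j
  have dd: "(\<lambda>y. frechet_derivative (\<lambda>y. \<delta> c y (e i)) (at y) (e j)) differentiable (at x)" for i j
    using smooth_on_differentiable[OF smooth_on_derivative[OF form_smooth[OF d c]] x] .
  have H: "H i j k = H i k j" for i j k
    unfolding H_def by (rule second_derivative_symmetric[OF o x form_smooth[OF d c]])
  have D1: "D i j k = H j i k - H i j k" for i j k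
    unfolding D_def H_def ext_deriv_def by (simp add: frechet_derivative_diff dd)
  have D2: "D i j k = \<beta> c x (e i) * P \<gamma> j k + P \<beta> i k * \<gamma> c x (e j) - (\<beta> c x (e j) * P \<gamma> i k + P \<beta> j k * \<gamma> c x (e i))" for i j k
  proof -
    have "frechet_derivative (\<lambda>y. ext_deriv \<delta> c y (e i) (e j)) (at x) = frechet_derivative (\<lambda>y. \<beta> c y (e i) * \<gamma> c y (e j) - \<beta> c y (e j) * \<gamma> c y (e i)) (at x)"
      by (rule frechet_derivative_cong_open[OF o x]) (use eq c in \<open>auto simp: eq_on_manifold_def wedge11_def\<close>)
    then show ?thesis unfolding D_def P_def
      using form_differentiable[OF M c x b] form_differentiable[OF M c x g]
      by (simp add: frechet_derivative_diff frechet_derivative_mult)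
  qed
  have "D 2 3 1 - D 1 3 2 + D 1 2 3 = 0"
    unfolding D1 using H[of 3 2 1] H[of 2 3 1] H[of 1 3 2] by (simp add: algebra_simps)
  then show ?thesis
    unfolding D2 density_of_def wedge12_def ext_deriv_def e_def[symmetric] P_def[symmetric] by (simp add: algebra_simps)
qed

section \<open>The Bott invariant as a self-pairing\<close>

lemma density_wedge_scale:
  assumes "\<And>v. \<sigma> c x v = f * \<tau> c x v"
  shows "density_of (wedge12 \<sigma> \<eta>) c x = f * density_of (wedge12 \<tau> \<eta>) c x"
  by (simp add: density_of_def wedge12_def assms algebra_simps)

text \<open>Differentiating \<open>d\<tau> = \<alpha> \<and> \<tau>\<close> gives \<open>d\<alpha> \<and> \<tau> = \<alpha> \<and> d\<tau> = \<alpha> \<and> \<alpha> \<and> \<tau> = 0\<close>.\<close>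

lemma bott_form_closed_along:
  fixes M :: "'a::t2_space chart set" and \<tau> \<alpha> :: "('a, complex) form1"
  assumes M: "oriented_atlas M" and t: "smooth_1form M \<tau>" and a: "smooth_1form M \<alpha>"
    and dt: "eq_on_manifold M (ext_deriv \<tau>) (wedge11 \<alpha> \<tau>)"
    and c: "c \<in> M" and x: "x \<in> chart_img c"
  shows "density_of (wedge12 \<tau> (ext_deriv \<alpha>)) c x = 0"
proof -
  have "density_of (wedge12 \<tau> (ext_deriv \<alpha>)) c x = density_of (wedge12 \<alpha> (ext_deriv \<tau>)) c x"
    by (rule wedge_deriv_commute[OF M a t t dt c x])
  also have "\<dots> = 0" using dt c x by (simp add: eq_on_manifold_def density_of_def wedge12_def wedge11_def algebra_simps)
  finally show ?thesis .
qed

text \<open>The 3-forms to be integrated vanish pointwise. For \<open>\<sigma> \<and> d\<alpha>\<close> this is \<open>\<tau> \<and> d\<alpha> = 0\<close>. For \<open>\<sigma> \<and> d\<sigma>\<close>,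
differentiating \<open>\<sigma> \<and> \<tau> = 0\<close> gives \<open>\<tau> \<and> d\<sigma> = \<sigma> \<and> d\<tau>\<close>, and this is a multiple of
\<open>\<tau> \<and> \<alpha> \<and> \<tau> = 0\<close>. The argument avoids differentiating the factor between \<open>\<sigma>\<close> and \<open>\<tau>\<close>, so that
only its pointwise existence is asked for.\<close>

lemma pairing_multiple_eq_0:
  fixes M :: "'a::t2_space chart set" and \<tau> \<alpha> \<sigma> :: "('a, complex) form1"
  assumes M: "oriented_atlas M" "compact (UNIV::'a set)" and t: "smooth_1form M \<tau>" and a: "smooth_1form M \<alpha>"
    and s: "smooth_1form M \<sigma>"
    and dt: "eq_on_manifold M (ext_deriv \<tau>) (wedge11 \<alpha> \<tau>)"
    and mult: "\<And>c x. c \<in> M \<Longrightarrow> x \<in> chart_img c \<Longrightarrow> \<exists>f. \<forall>v. \<sigma> c x v = f * \<tau> c x v"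
  shows "pairing M \<sigma> \<sigma> = 0" "pairing M \<sigma> \<alpha> = 0"
proof -
  show "pairing M \<sigma> \<alpha> = 0"
  proof (rule pairing_eq_0[OF M s a])
    fix c x assume c: "c \<in> M" and x: "x \<in> chart_img c"
    obtain f where "\<And>v. \<sigma> c x v = f * \<tau> c x v" using mult[OF c x] by blast
    from density_wedge_scale[of \<sigma> c x f \<tau>, OF this] bott_form_closed_along[OF M(1) t a dt c x]
    show "density_of (wedge12 \<sigma> (ext_deriv \<alpha>)) c x = 0" by simp
  qed
  show "pairing M \<sigma> \<sigma> = 0"
  proof (rule pairing_eq_0[OF M s s])
    fix c x assume c: "c \<in> M" and x: "x \<in> chart_img c"
    obtain f where f: "\<And>v. \<sigma> c x v = f * \<tau> c x v" using mult[OF c x] by blast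
    have "wedge11 \<sigma> \<tau> c x u v = 0" if "c \<in> M" "x \<in> chart_img c" for c x u v
      using mult[OF that] by (auto simp: wedge11_def)
    then have eq: "eq_on_manifold M (ext_deriv (\<lambda>c x v. 0)) (wedge11 \<sigma> \<tau>)"
      by (simp add: eq_on_manifold_def ext_deriv_def fun_eq_iff)
    have "density_of (wedge12 \<tau> (ext_deriv \<sigma>)) c x = density_of (wedge12 \<sigma> (ext_deriv \<tau>)) c x"
      by (rule wedge_deriv_commute[OF M(1) s t smooth_1form_zero eq c x])
    also have "\<dots> = 0" using dt c x by (simp add: eq_on_manifold_def density_of_def wedge12_def wedge11_def f algebra_simps)
    finally show "density_of (wedge12 \<sigma> (ext_deriv \<sigma>)) c x = 0"
      using density_wedge_scale[of \<sigma> c x f \<tau>, OF f] by simp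
  qed
qed

text \<open>Two choices of \<open>\<alpha>\<close> differ by a form \<open>\<gamma>\<close> with \<open>\<gamma> \<and> \<omega> = 0\<close>, that is, by a multiple of \<open>\<omega>\<close>. Expanding
\<open>\<langle>\<alpha> + \<gamma>, \<alpha> + \<gamma>\<rangle>\<close> with the symmetric pairing, all terms but the first vanish.\<close>

lemma bott_invariant_eq_pairing:
  fixes M :: "'a::t2_space chart set" and \<omega> \<alpha> :: "('a, complex) form1"
  assumes M: "oriented_atlas M" "compact (UNIV::'a set)" and w: "smooth_1form M \<omega>"
    and nz: "\<And>c x. c \<in> M \<Longrightarrow> x \<in> chart_img c \<Longrightarrow> \<exists>v. \<omega> c x v \<noteq> 0"
    and a: "smooth_1form M \<alpha>" and dw: "eq_on_manifold M (ext_deriv \<omega>) (wedge11 \<alpha> \<omega>)"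
  shows "bott_invariant M \<omega> = pairing M \<alpha> \<alpha>"
proof -
  have "pairing M \<beta> \<beta> = pairing M \<alpha> \<alpha>"
    if b: "smooth_1form M \<beta>" and db: "eq_on_manifold M (ext_deriv \<omega>) (wedge11 \<beta> \<omega>)" for \<beta>
  proof -
    define \<gamma> where "\<gamma> = (\<lambda>c x v. \<beta> c x v + - \<alpha> c x v)"
    have g: "smooth_1form M \<gamma>" unfolding \<gamma>_def
      by (intro smooth_1form_add[OF M(1)] b smooth_1form_bounded_linear[OF M(1) bounded_linear_uminus] a)
    have b_eq: "\<beta> = (\<lambda>c x v. \<alpha> c x v + \<gamma> c x v)" by (simp add: \<gamma>_def)
    have mult: "\<exists>f. \<forall>v. \<gamma> c x v = f * \<omega> c x v" if c: "c \<in> M" and x: "x \<in> chart_img c" for c x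
    proof -
      obtain u where u: "\<omega> c x u \<noteq> 0" using nz[OF c x] by blast
      have "wedge11 \<alpha> \<omega> c x = wedge11 \<beta> \<omega> c x" using dw db c x by (simp add: eq_on_manifold_def)
      then have "wedge11 \<alpha> \<omega> c x u v = wedge11 \<beta> \<omega> c x u v" for v by simp
      then have "\<gamma> c x v * \<omega> c x u = \<gamma> c x u * \<omega> c x v" for v
        by (simp add: \<gamma>_def wedge11_def algebra_simps)
      then have "\<gamma> c x v = (\<gamma> c x u / \<omega> c x u) * \<omega> c x v" for v using u by (simp add: field_simps)
      then show ?thesis by blast
    qed
    note z = pairing_multiple_eq_0[OF M w a g dw mult]
    show ?thesis
      unfolding b_eq
      by (simp add: pairing_add1[OF M] pairing_add2[OF M] a g smooth_1form_add[OF M(1)] z pairing_symmetric[OF M a g])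
  qed
  then show ?thesis unfolding bott_invariant_def
    by (intro the_equality) (use a dw in blast)+
qed

section \<open>Coefficients with respect to a transverse coframe\<close>

text \<open>The coefficient \<open>a\<close> is determined by \<open>\<theta> \<and> \<eta> = a \<omega> \<and> \<eta>\<close>. Contracting both sides with the conjugate
components of \<open>\<omega> \<and> \<eta>\<close> writes it as a quotient of smooth functions with nowhere zero denominator.
Its uniqueness makes it independent of the chart.\<close>

lemma smooth_coefficient:
  fixes M :: "'a::t2_space chart set" and \<omega> \<eta> \<theta> :: "('a, complex) form1"
  assumes M: "oriented_atlas M" and w: "smooth_1form M \<omega>" and e: "smooth_1form M \<eta>" and t: "smooth_1form M \<theta>"
    and indep: "\<And>c x. c \<in> M \<Longrightarrow> x \<in> chart_img c \<Longrightarrow> \<exists>u v. wedge11 \<omega> \<eta> c x u v \<noteq> 0"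
    and span: "\<And>c x. c \<in> M \<Longrightarrow> x \<in> chart_img c \<Longrightarrow> \<exists>b. \<forall>v. \<theta> c x v = a c x * \<omega> c x v + b * \<eta> c x v"
  shows "smooth_0form M a"
  unfolding smooth_0form_def
proof (intro conjI ballI)
  fix c assume c: "c \<in> M"
  have o: "open (chart_img c)" using chart_open_img atlas_is_chart[OF M c] by blast
  define W where "W \<alpha> i j x = wedge11 \<alpha> \<eta> c x (axis i 1) (axis j 1)" for \<alpha> i j x
  \<comment> \<open>The squared length of \<open>\<omega> \<and> \<eta>\<close>, and below the Hermitian product of \<open>\<theta> \<and> \<eta>\<close> with \<open>\<omega> \<and> \<eta>\<close>.\<close>
  define N where "N x = (\<Sum>i\<in>UNIV. \<Sum>j\<in>UNIV. W \<omega> i j x * cnj (W \<omega> i j x))" for x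
  define P where "P x = (\<Sum>i\<in>UNIV. \<Sum>j\<in>UNIV. W \<theta> i j x * cnj (W \<omega> i j x))" for x
  have sW: "smooth_on (chart_img c) (W \<alpha> i j)" if "smooth_1form M \<alpha>" for \<alpha> i j
    unfolding W_def wedge11_def
    by (intro smooth_on_diff smooth_on_mult o form_smooth[OF that c] form_smooth[OF e c])
  have sN: "smooth_on (chart_img c) N" and sP: "smooth_on (chart_img c) P"
    unfolding N_def P_def
    by (intro smooth_on_sum smooth_on_mult o sW w t smooth_on_bounded_linear[OF o bounded_linear_cnj])+
  have N0: "N x \<noteq> 0" if x: "x \<in> chart_img c" for x
  proof
    assume "N x = 0"
    moreover have "N x = of_real (\<Sum>i\<in>UNIV. \<Sum>j\<in>UNIV. (cmod (W \<omega> i j x))\<^sup>2)"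
      unfolding N_def by (simp add: complex_norm_square del: of_real_power)
    ultimately have "(\<Sum>i\<in>UNIV. \<Sum>j\<in>UNIV. (cmod (W \<omega> i j x))\<^sup>2) = 0" by (simp only: of_real_eq_0_iff)
    then have Wz: "W \<omega> i j x = 0" for i j
      by (simp add: sum_nonneg_eq_0_iff sum_nonneg)
    have "wedge11 \<omega> \<eta> c x u v = (\<Sum>i\<in>UNIV. \<Sum>j\<in>UNIV. of_real (u $ i * v $ j) * W \<omega> i j x)" for u v
    proof -
      have "wedge11 \<omega> \<eta> c x u v = (\<Sum>i\<in>UNIV. u $ i *\<^sub>R \<omega> c x (axis i 1)) * (\<Sum>i\<in>UNIV. v $ i *\<^sub>R \<eta> c x (axis i 1))
         - (\<Sum>i\<in>UNIV. v $ i *\<^sub>R \<omega> c x (axis i 1)) * (\<Sum>i\<in>UNIV. u $ i *\<^sub>R \<eta> c x (axis i 1))"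
        unfolding wedge11_def
        using linear_axis_expand[OF form_linear[OF w c x], of u] linear_axis_expand[OF form_linear[OF e c x], of u]
          linear_axis_expand[OF form_linear[OF w c x], of v] linear_axis_expand[OF form_linear[OF e c x], of v] by metis
      then show ?thesis unfolding W_def wedge11_def
        by (simp add: sum_3 scaleR_conv_of_real algebra_simps)
    qed
    then show False using indep[OF c x] Wz by simp
  qed
  have "a c x = P x / N x" if x: "x \<in> chart_img c" for x
  proof -
    obtain b where "\<And>v. \<theta> c x v = a c x * \<omega> c x v + b * \<eta> c x v" using span[OF c x] by blast
    then have "W \<theta> i j x = a c x * W \<omega> i j x" for i j by (simp add: W_def wedge11_def algebra_simps)
    then have "P x = a c x * N x" by (simp add: P_def N_def sum_distrib_left mult.assoc)
    then show ?thesis using N0[OF x] by simp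
  qed
  then show "smooth_on (chart_img c) (a c)"
    using smooth_on_cong[OF o, of "a c" "\<lambda>x. P x / N x"] smooth_on_divide[OF o sP sN N0] by blast
next
  fix c d x assume c: "c \<in> M" and d: "d \<in> M" and x: "x \<in> overlap c d"
  have ch: "is_chart c" "is_chart d" using M c d atlas_is_chart by blast+
  have xc: "x \<in> chart_img c" using x overlap_subset[OF ch(1)] by blast
  have Tx: "transition c d x \<in> chart_img d" using transition_in_overlap[OF ch x] overlap_subset[OF ch(2)] by blast
  obtain b where b: "\<And>v. \<theta> c x v = a c x * \<omega> c x v + b * \<eta> c x v" using span[OF c xc] by blast
  obtain b' where "\<And>v. \<theta> d (transition c d x) v = a d (transition c d x) * \<omega> d (transition c d x) v + b' * \<eta> d (transition c d x) v"
    using span[OF d Tx] by blast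
  then have b': "\<theta> c x v = a d (transition c d x) * \<omega> c x v + b' * \<eta> c x v" for v
    using form_transform[OF w c d x] form_transform[OF e c d x] form_transform[OF t c d x] by simp
  obtain u v where uv: "wedge11 \<omega> \<eta> c x u v \<noteq> 0" using indep[OF c xc] by blast
  have "wedge11 \<theta> \<eta> c x u v = a c x * wedge11 \<omega> \<eta> c x u v" using b by (simp add: wedge11_def algebra_simps)
  moreover have "wedge11 \<theta> \<eta> c x u v = a d (transition c d x) * wedge11 \<omega> \<eta> c x u v"
    using b' by (simp add: wedge11_def algebra_simps)
  ultimately show "a c x = a d (transition c d x)" using uv by simp
qed

lemma smooth_coefficients:
  fixes M :: "'a::t2_space chart set" and \<omega> \<eta> \<theta> :: "('a, complex) form1"
  assumes M: "oriented_atlas M" and w: "smooth_1form M \<omega>" and e: "smooth_1form M \<eta>" and t: "smooth_1form M \<theta>"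
    and indep: "\<And>c x. c \<in> M \<Longrightarrow> x \<in> chart_img c \<Longrightarrow> \<exists>u v. wedge11 \<omega> \<eta> c x u v \<noteq> 0"
    and span: "\<And>c x. c \<in> M \<Longrightarrow> x \<in> chart_img c \<Longrightarrow> \<exists>a b. \<forall>v. \<theta> c x v = a * \<omega> c x v + b * \<eta> c x v"
  obtains a b where "smooth_0form M a" "smooth_0form M b"
    "\<And>c x v. c \<in> M \<Longrightarrow> x \<in> chart_img c \<Longrightarrow> \<theta> c x v = a c x * \<omega> c x v + b c x * \<eta> c x v"
proof -
  have "\<forall>c x. \<exists>ab. c \<in> M \<longrightarrow> x \<in> chart_img c \<longrightarrow> (\<forall>v. \<theta> c x v = fst ab * \<omega> c x v + snd ab * \<eta> c x v)"
    using span by (metis fst_conv snd_conv)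
  then obtain ab where ab: "\<And>c x v. c \<in> M \<Longrightarrow> x \<in> chart_img c \<Longrightarrow> \<theta> c x v = fst (ab c x) * \<omega> c x v + snd (ab c x) * \<eta> c x v"
    by metis
  have "smooth_0form M (\<lambda>c x. fst (ab c x))"
    by (rule smooth_coefficient[OF M w e t indep]) (use ab in \<open>auto intro!: exI[of _ "snd (ab _ _)"]\<close>)
  moreover have "smooth_0form M (\<lambda>c x. snd (ab c x))"
  proof (rule smooth_coefficient[OF M e w t])
    fix c x assume cx: "c \<in> M" "x \<in> chart_img c"
    obtain u v where "wedge11 \<omega> \<eta> c x u v \<noteq> 0" using indep[OF cx] by blast
    then have "wedge11 \<eta> \<omega> c x v u \<noteq> 0" by (simp add: wedge11_def mult.commute)
    then show "\<exists>u v. wedge11 \<eta> \<omega> c x u v \<noteq> 0" by blast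
    have "\<forall>v. \<theta> c x v = snd (ab c x) * \<eta> c x v + fst (ab c x) * \<omega> c x v" using ab[OF cx] by simp
    then show "\<exists>b. \<forall>v. \<theta> c x v = snd (ab c x) * \<eta> c x v + b * \<omega> c x v" by blast
  qed
  ultimately show thesis using that ab by blast
qed

text \<open>Cramer's rule: the hypothesis says that \<open>w \<and> e \<and> t\<close> vanishes on \<open>u, v, z\<close>, for fixed \<open>u\<close> and \<open>v\<close> on
which \<open>w \<and> e\<close> does not vanish.\<close>

lemma span_of_wedge_eq_0:
  fixes w e t :: "'v \<Rightarrow> complex"
  assumes uv: "w u * e v - w v * e u \<noteq> 0"
    and eq: "\<And>z. t z * (w u * e v - w v * e u) = t u * (w z * e v - w v * e z) + t v * (w u * e z - w z * e u)"
  shows "\<exists>a b. \<forall>z. t z = a * w z + b * e z"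
proof (intro exI allI)
  fix z
  let ?D = "w u * e v - w v * e u"
  have "t z * ?D = (t u * e v - t v * e u) * w z + (w u * t v - w v * t u) * e z"
    using eq[of z] by (simp add: algebra_simps)
  then show "t z = ((t u * e v - t v * e u) / ?D) * w z + ((w u * t v - w v * t u) / ?D) * e z"
    using uv by (simp add: divide_simps)
qed

section \<open>Forms with the same foliation\<close>

text \<open>The heart of the proof. The pair \<open>(\<omega>, \<eta>)\<close> generalises a form and its complex conjugate; only the
structure equations with opposite \<open>\<beta>\<close> matter. In this form the statement applies equally with the
two forms exchanged.\<close>

lemma bott_form_of_combination:
  fixes M :: "'a::t2_space chart set" and \<omega> \<eta> \<omega>' \<beta> :: "('a, complex) form1"
  assumes M: "oriented_atlas M" "compact (UNIV::'a set)"
    and w: "smooth_1form M \<omega>" and e: "smooth_1form M \<eta>" and b: "smooth_1form M \<beta>" and w': "smooth_1form M \<omega>'"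
    and dw: "eq_on_manifold M (ext_deriv \<omega>) (wedge11 \<beta> \<omega>)"
    and de: "eq_on_manifold M (ext_deriv \<eta>) (wedge11 (\<lambda>c x v. - \<beta> c x v) \<eta>)"
    and indep: "\<And>c x. c \<in> M \<Longrightarrow> x \<in> chart_img c \<Longrightarrow> \<exists>u v. wedge11 \<omega> \<eta> c x u v \<noteq> 0"
    and int: "eq_on_manifold M (wedge12 \<omega>' (ext_deriv \<omega>')) (\<lambda>c x u v w. 0)"
    and p: "smooth_0form M p" and q: "smooth_0form M q"
    and w'_eq: "\<And>c x v. c \<in> M \<Longrightarrow> x \<in> chart_img c \<Longrightarrow> \<omega>' c x v = p c x * \<omega> c x v + q c x * \<eta> c x v"
    and pnz: "\<And>c x. c \<in> M \<Longrightarrow> x \<in> chart_img c \<Longrightarrow> p c x \<noteq> 0"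
  shows "\<exists>\<alpha>. smooth_1form M \<alpha> \<and> eq_on_manifold M (ext_deriv \<omega>') (wedge11 \<alpha> \<omega>') \<and> pairing M \<alpha> \<alpha> = pairing M \<beta> \<beta>"
proof -
  define \<delta> where "\<delta> = log_differential p"
  have d: "smooth_1form M \<delta>" unfolding \<delta>_def by (rule smooth_1form_log_differential[OF M(1) p pnz])
  have dd: "ext_deriv \<delta> c x u v = 0" if "c \<in> M" "x \<in> chart_img c" for c x u v
    unfolding \<delta>_def using ext_deriv_log_differential[OF M(1) p pnz that] .
  have dp: "differential p c x v = p c x * \<delta> c x v" if "c \<in> M" "x \<in> chart_img c" for c x v
    using pnz[OF that] by (simp add: \<delta>_def log_differential_def)
  \<comment> \<open>Chosen so that \<open>d\<omega>' = (\<delta> + \<beta>) \<and> \<omega>' + \<theta> \<and> \<eta>\<close>; the factor \<open>2\<close> comes from the opposite signs of \<open>\<beta>\<close> in the structure equations of \<open>\<omega>\<close> and \<open>\<eta>\<close>.\<close>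
  define \<theta> where "\<theta> = (\<lambda>c x v. differential q c x v + ((-1 * q c x) * \<delta> c x v + (-2 * q c x) * \<beta> c x v))"
  have t: "smooth_1form M \<theta>" unfolding \<theta>_def
    by (intro smooth_1form_add[OF M(1)] smooth_1form_scale[OF M(1)] smooth_1form_differential[OF M(1)] smooth_0form_cmult[OF M(1)] q d b)
  have dw': "ext_deriv \<omega>' c x u v = (\<delta> c x u + \<beta> c x u) * \<omega>' c x v - (\<delta> c x v + \<beta> c x v) * \<omega>' c x u
      + wedge11 \<theta> \<eta> c x u v" if c: "c \<in> M" and x: "x \<in> chart_img c" for c x u v
  proof -
    have o: "open (chart_img c)" using chart_open_img atlas_is_chart[OF M(1) c] by blast
    have "frechet_derivative (\<lambda>y. \<omega>' c y v) (at x) = frechet_derivative (\<lambda>y. p c y * \<omega> c y v + q c y * \<eta> c y v) (at x)" for v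
      by (rule frechet_derivative_cong_open[OF o x w'_eq[OF c]])
    then have "ext_deriv \<omega>' c x u v = ext_deriv (\<lambda>c x v. p c x * \<omega> c x v + q c x * \<eta> c x v) c x u v"
      by (simp add: ext_deriv_def)
    also have "\<dots> = (wedge11 (differential p) \<omega> c x u v + p c x * ext_deriv \<omega> c x u v)
       + (wedge11 (differential q) \<eta> c x u v + q c x * ext_deriv \<eta> c x u v)"
      by (simp add: ext_deriv_add[OF M(1) c x smooth_1form_scale[OF M(1) p w] smooth_1form_scale[OF M(1) q e]]
          ext_deriv_scale[OF M(1) c x p w] ext_deriv_scale[OF M(1) c x q e])
    also have "ext_deriv \<omega> c x u v = wedge11 \<beta> \<omega> c x u v" using dw c x by (simp add: eq_on_manifold_def)
    also have "ext_deriv \<eta> c x u v = wedge11 (\<lambda>c x v. - \<beta> c x v) \<eta> c x u v" using de c x by (simp add: eq_on_manifold_def)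
    finally show ?thesis
      by (simp add: wedge11_def \<theta>_def dp[OF c x] w'_eq[OF c x] algebra_simps)
  qed
  have span: "\<exists>a b. \<forall>v. \<theta> c x v = a * \<omega> c x v + b * \<eta> c x v" if c: "c \<in> M" and x: "x \<in> chart_img c" for c x
  proof -
    obtain u v where uv: "wedge11 \<omega> \<eta> c x u v \<noteq> 0" using indep[OF c x] by blast
    show ?thesis
    proof (rule span_of_wedge_eq_0)
      show "\<omega> c x u * \<eta> c x v - \<omega> c x v * \<eta> c x u \<noteq> 0" using uv by (simp add: wedge11_def)
      fix z
      have "wedge12 \<omega>' (ext_deriv \<omega>') c x z u v = 0" using int c x by (simp add: eq_on_manifold_def)
      \<comment> \<open>In \<open>\<omega>' \<and> d\<omega>'\<close> only \<open>\<omega>' \<and> \<theta> \<and> \<eta> = p \<omega> \<and> \<theta> \<and> \<eta>\<close> survives.\<close>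
      then have "p c x * (\<omega> c x z * wedge11 \<theta> \<eta> c x u v - \<omega> c x u * wedge11 \<theta> \<eta> c x z v + \<omega> c x v * wedge11 \<theta> \<eta> c x z u) = 0"
        unfolding wedge12_def dw'[OF c x] w'_eq[OF c x] wedge11_def by (simp add: algebra_simps)
      then have "\<omega> c x z * wedge11 \<theta> \<eta> c x u v - \<omega> c x u * wedge11 \<theta> \<eta> c x z v + \<omega> c x v * wedge11 \<theta> \<eta> c x z u = 0"
        using pnz[OF c x] by simp
      then show "\<theta> c x z * (\<omega> c x u * \<eta> c x v - \<omega> c x v * \<eta> c x u) =
         \<theta> c x u * (\<omega> c x z * \<eta> c x v - \<omega> c x v * \<eta> c x z) + \<theta> c x v * (\<omega> c x u * \<eta> c x z - \<omega> c x z * \<eta> c x u)"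
        by (simp add: wedge11_def algebra_simps)
    qed
  qed
  obtain a b' where a: "smooth_0form M a"
    and ab: "\<And>c x v. c \<in> M \<Longrightarrow> x \<in> chart_img c \<Longrightarrow> \<theta> c x v = a c x * \<omega> c x v + b' c x * \<eta> c x v"
    using smooth_coefficients[OF M(1) w e t indep span] by metis
  \<comment> \<open>Solves \<open>\<sigma> \<and> \<omega>' = \<theta> \<and> \<eta>\<close>, as \<open>\<omega>' \<and> \<eta> = p \<omega> \<and> \<eta>\<close> and \<open>\<theta> \<and> \<eta> = a \<omega> \<and> \<eta>\<close>.\<close>
  define \<sigma> where "\<sigma> = (\<lambda>c x v. (-1 * (a c x / p c x)) * \<eta> c x v)"
  have s: "smooth_1form M \<sigma>" unfolding \<sigma>_def
    by (intro smooth_1form_scale[OF M(1)] smooth_0form_cmult[OF M(1)] smooth_0form_divide[OF M(1) a p pnz] e)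
  define \<alpha> where "\<alpha> = (\<lambda>c x v. \<delta> c x v + (\<beta> c x v + \<sigma> c x v))"
  have bs: "smooth_1form M (\<lambda>c x v. \<beta> c x v + \<sigma> c x v)" by (rule smooth_1form_add[OF M(1) b s])
  have al: "smooth_1form M \<alpha>" unfolding \<alpha>_def by (rule smooth_1form_add[OF M(1) d bs])
  have "ext_deriv \<omega>' c x u v = wedge11 \<alpha> \<omega>' c x u v" if c: "c \<in> M" and x: "x \<in> chart_img c" for c x u v
    unfolding dw'[OF c x] wedge11_def \<alpha>_def \<sigma>_def ab[OF c x] w'_eq[OF c x]
    using pnz[OF c x] by (simp add: field_simps)
  then have "eq_on_manifold M (ext_deriv \<omega>') (wedge11 \<alpha> \<omega>')" by (simp add: eq_on_manifold_def fun_eq_iff)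
  moreover have "pairing M \<alpha> \<alpha> = pairing M \<beta> \<beta>"
  proof -
    have z: "pairing M \<gamma> \<delta> = 0" if "smooth_1form M \<gamma>" for \<gamma>
      by (rule pairing_eq_0[OF M that d]) (simp add: density_of_def wedge12_def dd)
    have z': "pairing M \<delta> \<gamma> = 0" if "smooth_1form M \<gamma>" for \<gamma>
      using z[OF that] pairing_symmetric[OF M d that] by simp
    have mb: "smooth_1form M (\<lambda>c x v. - \<beta> c x v)"
      by (rule smooth_1form_bounded_linear[OF M(1) bounded_linear_uminus b])
    have mult: "\<exists>f. \<forall>v. \<sigma> c x v = f * \<eta> c x v" for c x unfolding \<sigma>_def by blast
    have ss: "pairing M \<sigma> \<sigma> = 0" by (rule pairing_multiple_eq_0[OF M e mb s de mult])
    have sb: "pairing M \<sigma> \<beta> = 0"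
    proof (rule pairing_eq_0[OF M s b])
      fix c x assume c: "c \<in> M" and x: "x \<in> chart_img c"
      have "density_of (wedge12 \<eta> (ext_deriv (\<lambda>c x v. - \<beta> c x v))) c x = 0"
        by (rule bott_form_closed_along[OF M(1) e mb de c x])
      then have "density_of (wedge12 \<eta> (ext_deriv \<beta>)) c x = 0"
        by (simp add: density_of_def wedge12_def ext_deriv_bounded_linear[OF M(1) c x bounded_linear_uminus b] algebra_simps)
      then show "density_of (wedge12 \<sigma> (ext_deriv \<beta>)) c x = 0"
        using density_wedge_scale[of \<sigma> c x "-1 * (a c x / p c x)" \<eta>] by (simp add: \<sigma>_def)
    qed
    have "pairing M \<alpha> \<alpha> = pairing M (\<lambda>c x v. \<beta> c x v + \<sigma> c x v) (\<lambda>c x v. \<beta> c x v + \<sigma> c x v)"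
      using pairing_add1[OF M d bs al] pairing_add2[OF M d bs bs] by (simp add: \<alpha>_def[symmetric] z[OF bs] z'[OF al])
    also have "\<dots> = pairing M \<beta> \<beta>"
      using pairing_add1[OF M b s bs] pairing_add2[OF M b s b] pairing_add2[OF M b s s] pairing_symmetric[OF M b s]
      by (simp add: ss sb)
    finally show ?thesis .
  qed
  ultimately show ?thesis using al by blast
qed

definition conj_form :: "('a, complex) form1 \<Rightarrow> ('a, complex) form1" where
  "conj_form \<omega> = (\<lambda>c x v. cnj (\<omega> c x v))"

lemma smooth_conj_form: "oriented_atlas M \<Longrightarrow> smooth_1form M \<omega> \<Longrightarrow> smooth_1form M (conj_form \<omega>)"
  unfolding conj_form_def using smooth_1form_bounded_linear[OF _ bounded_linear_cnj] .

text \<open>Up to the factor \<open>- 2 \<i>\<close>, \<open>\<omega> \<and> cnj \<omega>\<close> is the wedge product of the real and imaginary parts of \<open>\<omega>\<close>;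
it detects their independence.\<close>

lemma wedge_conj_form: "wedge11 \<omega> (conj_form \<omega>) c x u v
   = - 2 * \<i> * of_real (Re (\<omega> c x u) * Im (\<omega> c x v) - Re (\<omega> c x v) * Im (\<omega> c x u))"
  by (simp add: wedge11_def conj_form_def complex_eq_iff algebra_simps)

lemma formally_integrableD:
  assumes "formally_integrable M \<omega>"
  shows "smooth_1form M \<omega>" and "eq_on_manifold M (wedge12 \<omega> (ext_deriv \<omega>)) (\<lambda>c x u v w. 0)"
  using assms unfolding formally_integrable_def by blast+

lemma formally_integrable_independent:
  assumes "formally_integrable M \<omega>" "c \<in> M" "x \<in> chart_img c"
  shows "\<exists>u v. Re (\<omega> c x u) * Im (\<omega> c x v) - Re (\<omega> c x v) * Im (\<omega> c x u) \<noteq> 0"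
proof (rule ccontr)
  have ind: "a = 0 \<and> b = 0" if "\<And>v. a * Re (\<omega> c x v) + b * Im (\<omega> c x v) = 0" for a b :: real
    using assms that unfolding formally_integrable_def by blast
  assume "\<not> ?thesis"
  then have z: "Im (\<omega> c x v) * Re (\<omega> c x u) + (- Re (\<omega> c x v)) * Im (\<omega> c x u) = 0" for u v
    by (simp add: algebra_simps)
  have "Im (\<omega> c x v) = 0 \<and> - Re (\<omega> c x v) = 0" for v by (rule ind) (rule z)
  then have "1 = (0::real) \<and> (0::real) = 0" by (intro ind) auto
  then show False by simp
qed

lemma formally_integrable_wedge_conj:
  assumes "formally_integrable M \<omega>" "c \<in> M" "x \<in> chart_img c"
  shows "\<exists>u v. wedge11 \<omega> (conj_form \<omega>) c x u v \<noteq> 0"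
proof -
  obtain u v where "Re (\<omega> c x u) * Im (\<omega> c x v) - Re (\<omega> c x v) * Im (\<omega> c x u) \<noteq> 0"
    using formally_integrable_independent[OF assms] by blast
  then have "wedge11 \<omega> (conj_form \<omega>) c x u v \<noteq> 0"
    unfolding wedge_conj_form by (simp del: of_real_diff of_real_mult)
  then show ?thesis by blast
qed

text \<open>Given \<open>u\<close> and \<open>v\<close> on which the real and imaginary parts of \<open>\<omega>\<close> are independent, every vector is a
real combination of \<open>u\<close>, \<open>v\<close> and an element of the common kernel, on which \<open>\<omega>'\<close> vanishes as well.\<close>

lemma same_foliation_span:
  assumes w: "formally_integrable M \<omega>" and w': "formally_integrable M \<omega>'" and same: "same_foliation M \<omega> \<omega>'"
    and c: "c \<in> M" and x: "x \<in> chart_img c"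
  shows "\<exists>a b. \<forall>v. \<omega>' c x v = a * \<omega> c x v + b * conj_form \<omega> c x v"
proof -
  define D where "D u v = Re (\<omega> c x u) * Im (\<omega> c x v) - Re (\<omega> c x v) * Im (\<omega> c x u)" for u v
  obtain u v where uv: "D u v \<noteq> 0" unfolding D_def using formally_integrable_independent[OF w c x] by blast
  have ker: "\<omega>' c x k = 0" if "\<omega> c x k = 0" for k
  proof -
    have "k \<in> line_field \<omega> c x" using that by (simp add: line_field_def)
    then have "k \<in> line_field \<omega>' c x" using same c x by (simp add: same_foliation_def eq_on_manifold_def)
    then show ?thesis by (simp add: line_field_def complex_eq_iff)
  qed
  have l: "linear (\<omega> c x)" "linear (\<omega>' c x)"
    using w w' c x form_linear unfolding formally_integrable_def by blast+
  have W: "\<omega> c x y * conj_form \<omega> c x z - \<omega> c x z * conj_form \<omega> c x y = - 2 * \<i> * of_real (D y z)" for y z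
    using wedge_conj_form[of \<omega> c x y z] by (simp add: wedge11_def D_def)
  show ?thesis
  proof (rule span_of_wedge_eq_0)
    show "\<omega> c x u * conj_form \<omega> c x v - \<omega> c x v * conj_form \<omega> c x u \<noteq> 0" unfolding W using uv by simp
    fix z
    \<comment> \<open>By Cramer's rule the component of \<open>z\<close> in the common kernel, up to the factor \<open>D u v\<close>.\<close>
    let ?k = "D u v *\<^sub>R z - D z v *\<^sub>R u - D u z *\<^sub>R v"
    have "\<omega> c x ?k = of_real (D u v) * \<omega> c x z - of_real (D z v) * \<omega> c x u - of_real (D u z) * \<omega> c x v"
      by (simp only: linear_diff[OF l(1)] linear_cmul[OF l(1)]) (simp add: scaleR_conv_of_real)
    also have "\<dots> = 0" by (simp add: complex_eq_iff D_def algebra_simps)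
    finally have "\<omega> c x ?k = 0" .
    then have "\<omega>' c x ?k = 0" by (rule ker)
    then have "D u v *\<^sub>R \<omega>' c x z - D z v *\<^sub>R \<omega>' c x u - D u z *\<^sub>R \<omega>' c x v = 0"
      by (simp only: linear_diff[OF l(2)] linear_cmul[OF l(2)])
    then have "of_real (D u v) * \<omega>' c x z = of_real (D z v) * \<omega>' c x u + of_real (D u z) * \<omega>' c x v"
      by (simp add: scaleR_conv_of_real algebra_simps)
    then show "\<omega>' c x z * (\<omega> c x u * conj_form \<omega> c x v - \<omega> c x v * conj_form \<omega> c x u) =
       \<omega>' c x u * (\<omega> c x z * conj_form \<omega> c x v - \<omega> c x v * conj_form \<omega> c x z) +
       \<omega>' c x v * (\<omega> c x u * conj_form \<omega> c x z - \<omega> c x z * conj_form \<omega> c x u)"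
      unfolding W by algebra
  qed
qed

text \<open>For \<open>\<omega>' = p \<omega> + q cnj \<omega>\<close> one has \<open>\<omega>' \<and> cnj \<omega>' = (\<bar>p\<bar>\<^sup>2 - \<bar>q\<bar>\<^sup>2) \<omega> \<and> cnj \<omega>\<close>, and the left-hand side is
nonzero. Geometrically, \<open>\<bar>p\<bar> > \<bar>q\<bar>\<close> and \<open>\<bar>p\<bar> < \<bar>q\<bar>\<close> correspond to the same and the opposite
transverse orientation.\<close>

lemma cmod_combination_neq:
  assumes w': "formally_integrable M \<omega>'" and c: "c \<in> M" and x: "x \<in> chart_img c"
    and eq: "\<And>v. \<omega>' c x v = p * \<omega> c x v + q * conj_form \<omega> c x v"
  shows "cmod p \<noteq> cmod q"
proof
  assume "cmod p = cmod q"
  then have n: "p * cnj p = q * cnj q" by (simp add: complex_norm_square[symmetric])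
  obtain u v where "wedge11 \<omega>' (conj_form \<omega>') c x u v \<noteq> 0" using formally_integrable_wedge_conj[OF w' c x] by blast
  moreover have "wedge11 \<omega>' (conj_form \<omega>') c x u v = (p * cnj p - q * cnj q) * wedge11 \<omega> (conj_form \<omega>) c x u v"
    by (simp add: wedge11_def conj_form_def eq algebra_simps)
  ultimately show False using n by simp
qed

text \<open>The sets where \<open>p\<close>, respectively \<open>q\<close>, has the larger modulus are open, disjoint, and cover the
connected manifold.\<close>

lemma dominance_constant:
  fixes M :: "'a::t2_space chart set" and p q :: "'a chart \<Rightarrow> real^3 \<Rightarrow> complex"
  assumes M: "oriented_atlas M" "connected (UNIV::'a set)"
    and p: "smooth_0form M p" and q: "smooth_0form M q"
    and neq: "\<And>c x. c \<in> M \<Longrightarrow> x \<in> chart_img c \<Longrightarrow> cmod (p c x) \<noteq> cmod (q c x)"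
  shows "(\<forall>c\<in>M. \<forall>x\<in>chart_img c. cmod (p c x) > cmod (q c x)) \<or> (\<forall>c\<in>M. \<forall>x\<in>chart_img c. cmod (q c x) > cmod (p c x))"
proof -
  define U where "U p q = (\<Union>c\<in>M. {y \<in> chart_dom c. cmod (p c (coord c y)) - cmod (q c (coord c y)) \<in> {0<..}})"
    for p q :: "'a chart \<Rightarrow> real^3 \<Rightarrow> complex"
  have oU: "open (U p q)" if p: "smooth_0form M p" and q: "smooth_0form M q" for p q
    unfolding U_def
  proof (intro open_UN ballI)
    fix c assume c: "c \<in> M"
    have ch: "is_chart c" using atlas_is_chart[OF M(1) c] .
    have sub: "coord c ` chart_dom c \<subseteq> chart_img c" by (simp add: chart_img_def)
    have "continuous_on (chart_dom c) (\<lambda>y. cmod (p c (coord c y)) - cmod (q c (coord c y)))"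
      by (intro continuous_intros continuous_on_compose2[OF smooth_on_continuous[OF zero_form_smooth[OF p c]] chart_continuous_coord[OF ch] sub]
         continuous_on_compose2[OF smooth_on_continuous[OF zero_form_smooth[OF q c]] chart_continuous_coord[OF ch] sub])
    from continuous_open_preimage[OF this chart_open_dom[OF ch], of "{0<..}"]
    show "open {y \<in> chart_dom c. cmod (p c (coord c y)) - cmod (q c (coord c y)) \<in> {0<..}}"
      by (simp add: vimage_def Int_def)
  qed
  have inv: "f c (coord c y) = f d (coord d y)" if "smooth_0form M f" "c \<in> M" "d \<in> M" "y \<in> chart_dom c" "y \<in> chart_dom d"
    for f :: "'a chart \<Rightarrow> real^3 \<Rightarrow> complex" and c d y
  proof -
    have "coord c y \<in> overlap c d" using that by (auto simp: overlap_def)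
    then show ?thesis
      using zero_form_transform[OF that(1-3)] chart_param_coord[OF atlas_is_chart[OF M(1) that(2)] that(4)]
      by (simp add: transition_def)
  qed
  have cov: "UNIV \<subseteq> U p q \<union> U q p"
  proof
    fix y :: 'a
    obtain c where c: "c \<in> M" "y \<in> chart_dom c" using atlas_cover[OF M(1)] by blast
    then have "cmod (p c (coord c y)) \<noteq> cmod (q c (coord c y))" by (intro neq) (auto simp: chart_img_def)
    then show "y \<in> U p q \<union> U q p" using c unfolding U_def by (force simp: neq_iff)
  qed
  have disj: "U p q \<inter> U q p \<inter> UNIV = {}"
  proof -
    have False if y: "y \<in> U p q" "y \<in> U q p" for y
    proof -
      obtain c where c: "c \<in> M" "y \<in> chart_dom c" "cmod (p c (coord c y)) - cmod (q c (coord c y)) > 0"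
        using y(1) by (auto simp: U_def)
      obtain d where d: "d \<in> M" "y \<in> chart_dom d" "cmod (q d (coord d y)) - cmod (p d (coord d y)) > 0"
        using y(2) by (auto simp: U_def)
      show False using c(3) d(3) inv[OF p c(1) d(1) c(2) d(2)] inv[OF q c(1) d(1) c(2) d(2)] by simp
    qed
    then show ?thesis by blast
  qed
  have key: "\<forall>c\<in>M. \<forall>x\<in>chart_img c. cmod (p c x) > cmod (q c x)"
    if e: "U q p = {}" and neq: "\<And>c x. c \<in> M \<Longrightarrow> x \<in> chart_img c \<Longrightarrow> cmod (p c x) \<noteq> cmod (q c x)" for p q
  proof (intro ballI)
    fix c x assume c: "c \<in> M" and x: "x \<in> chart_img c"
    have ch: "is_chart c" using atlas_is_chart[OF M(1) c] .
    have "param c x \<notin> U q p" using e by simp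
    then have "\<not> cmod (q c x) - cmod (p c x) > 0"
      using c chart_param_in[OF ch x] chart_coord_param[OF ch x] unfolding U_def by auto
    then show "cmod (p c x) > cmod (q c x)" using neq[OF c x] by linarith
  qed
  have "U p q \<inter> UNIV = {} \<or> U q p \<inter> UNIV = {}"
    using connectedD[OF M(2) oU[OF p q] oU[OF q p] disj cov] .
  then show ?thesis using key[of q p] key[of p q] neq by (metis inf_top_right)
qed

theorem theorem3p3:
  fixes M :: "'a::t2_space chart set"
    and \<omega> \<omega>' :: "('a, complex) form1"
  assumes "closed_connected_oriented_3manifold M"
    and "formally_integrable M \<omega>"
    and "\<exists>\<alpha> :: ('a, real) form1. smooth_1form M \<alpha> \<and>
           eq_on_manifold M (ext_deriv \<omega>) (wedge11 (imag_form \<alpha>) \<omega>)"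
    and "formally_integrable M \<omega>'"
    and "same_foliation M \<omega> \<omega>'"
  shows "bott_invariant M \<omega>' = bott_invariant M \<omega>"
proof -
  have M: "oriented_atlas M" "compact (UNIV::'a set)" "connected (UNIV::'a set)"
    using assms(1) by (auto simp: closed_connected_oriented_3manifold_def)
  note w = formally_integrableD(1)[OF assms(2)] and w' = formally_integrableD(1)[OF assms(4)]
    and int' = formally_integrableD(2)[OF assms(4)]
  have nz: "\<exists>v. \<tau> c x v \<noteq> 0" if fi: "formally_integrable M \<tau>" "c \<in> M" "x \<in> chart_img c" for \<tau> c x
  proof -
    obtain u v where uv: "wedge11 \<tau> (conj_form \<tau>) c x u v \<noteq> 0" using formally_integrable_wedge_conj[OF fi] by blast
    show ?thesis by (rule ccontr) (use uv in \<open>simp add: wedge11_def\<close>)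
  qed
  obtain \<alpha> :: "('a, real) form1" where a: "smooth_1form M \<alpha>"
    and dw: "eq_on_manifold M (ext_deriv \<omega>) (wedge11 (imag_form \<alpha>) \<omega>)" using assms(3) by blast
  define \<beta> where "\<beta> = imag_form \<alpha>"
  define \<eta> where "\<eta> = conj_form \<omega>"
  have "bounded_linear (\<lambda>r. \<i> * complex_of_real r)"
    by (rule bounded_linear_const_mult[OF bounded_linear_of_real])
  then have b: "smooth_1form M \<beta>" unfolding \<beta>_def imag_form_def
    by (rule smooth_1form_bounded_linear[OF M(1) _ a])
  have mb: "smooth_1form M (\<lambda>c x v. - \<beta> c x v)"
    by (rule smooth_1form_bounded_linear[OF M(1) bounded_linear_uminus b])
  have e: "smooth_1form M \<eta>" unfolding \<eta>_def by (rule smooth_conj_form[OF M(1) w])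
  have dw: "eq_on_manifold M (ext_deriv \<omega>) (wedge11 \<beta> \<omega>)" using dw by (simp add: \<beta>_def)
  have de: "eq_on_manifold M (ext_deriv \<eta>) (wedge11 (\<lambda>c x v. - \<beta> c x v) \<eta>)"
    unfolding eq_on_manifold_def
  proof (intro ballI ext)
    fix c x u v assume c: "c \<in> M" and x: "x \<in> chart_img c"
    have "ext_deriv \<eta> c x u v = cnj (ext_deriv \<omega> c x u v)"
      unfolding \<eta>_def conj_form_def by (rule ext_deriv_bounded_linear[OF M(1) c x bounded_linear_cnj w])
    also have "ext_deriv \<omega> c x u v = wedge11 \<beta> \<omega> c x u v" using dw c x by (simp add: eq_on_manifold_def)
    finally show "ext_deriv \<eta> c x u v = wedge11 (\<lambda>c x v. - \<beta> c x v) \<eta> c x u v"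
      by (simp add: wedge11_def \<eta>_def conj_form_def \<beta>_def imag_form_def)
  qed
  have indep: "\<exists>u v. wedge11 \<omega> \<eta> c x u v \<noteq> 0" if "c \<in> M" "x \<in> chart_img c" for c x
    unfolding \<eta>_def using formally_integrable_wedge_conj[OF assms(2) that] .
  have indep': "\<exists>u v. wedge11 \<eta> \<omega> c x u v \<noteq> 0" if cx: "c \<in> M" "x \<in> chart_img c" for c x
  proof -
    obtain u v where "wedge11 \<omega> \<eta> c x u v \<noteq> 0" using indep[OF cx] by blast
    then have "wedge11 \<eta> \<omega> c x v u \<noteq> 0" by (simp add: wedge11_def mult.commute)
    then show ?thesis by blast
  qed
  have span: "\<exists>a b. \<forall>v. \<omega>' c x v = a * \<omega> c x v + b * \<eta> c x v" if "c \<in> M" "x \<in> chart_img c" for c x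
    unfolding \<eta>_def using same_foliation_span[OF assms(2,4,5) that] .
  obtain p q where p: "smooth_0form M p" and q: "smooth_0form M q"
    and pq: "\<And>c x v. c \<in> M \<Longrightarrow> x \<in> chart_img c \<Longrightarrow> \<omega>' c x v = p c x * \<omega> c x v + q c x * \<eta> c x v"
    using smooth_coefficients[OF M(1) w e w' indep span] by blast
  have "cmod (p c x) \<noteq> cmod (q c x)" if "c \<in> M" "x \<in> chart_img c" for c x
    using cmod_combination_neq[OF assms(4) that] pq[OF that] unfolding \<eta>_def by blast
  from dominance_constant[OF M(1,3) p q this]
  have "\<exists>\<gamma>. smooth_1form M \<gamma> \<and> eq_on_manifold M (ext_deriv \<omega>') (wedge11 \<gamma> \<omega>') \<and> pairing M \<gamma> \<gamma> = pairing M \<beta> \<beta>"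
  proof
    assume "\<forall>c\<in>M. \<forall>x\<in>chart_img c. cmod (p c x) > cmod (q c x)"
    then have pnz: "p c x \<noteq> 0" if "c \<in> M" "x \<in> chart_img c" for c x using that by fastforce
    show ?thesis by (rule bott_form_of_combination[OF M(1,2) w e b w' dw de indep int' p q pq pnz])
  next
    assume "\<forall>c\<in>M. \<forall>x\<in>chart_img c. cmod (q c x) > cmod (p c x)"
    then have qnz: "q c x \<noteq> 0" if "c \<in> M" "x \<in> chart_img c" for c x using that by fastforce
    \<comment> \<open>The roles of \<open>\<omega>\<close> and \<open>\<eta>\<close> are exchanged, and \<open>\<beta>\<close> changes sign.\<close>
    have dw2: "eq_on_manifold M (ext_deriv \<omega>) (wedge11 (\<lambda>c x v. - (- \<beta> c x v)) \<omega>)" using dw by simp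
    have qp: "\<omega>' c x v = q c x * \<eta> c x v + p c x * \<omega> c x v" if "c \<in> M" "x \<in> chart_img c" for c x v
      using pq[OF that] by simp
    have "pairing M (\<lambda>c x v. - \<beta> c x v) (\<lambda>c x v. - \<beta> c x v) = pairing M \<beta> \<beta>"
      by (rule pairing_eq[OF M(1,2) mb mb b b])
        (simp add: density_of_def wedge12_def ext_deriv_bounded_linear[OF M(1) _ _ bounded_linear_uminus b])
    then show ?thesis
      using bott_form_of_combination[OF M(1,2) e w mb w' de dw2 indep' int' q p qp qnz] by simp
  qed
  then obtain \<gamma> where "smooth_1form M \<gamma>" "eq_on_manifold M (ext_deriv \<omega>') (wedge11 \<gamma> \<omega>')" "pairing M \<gamma> \<gamma> = pairing M \<beta> \<beta>"
    by blast
  then show ?thesis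
    using bott_invariant_eq_pairing[OF M(1,2) w' nz[OF assms(4)]] bott_invariant_eq_pairing[OF M(1,2) w nz[OF assms(2)] b dw] by simp
qed

end
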